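(* Let $\Lambda$ be a finite measure on $[0,1]$ with $\Lambda(\{1\})=0$. Let $\mathbb D=\mathbb D([0,\infty),\mathcal M_1)$ be the space of càdlàg $\mathcal M_1$-valued functions with the Skorohod topology, $\mathbf P$ the distribution on $\mathbb D$ of the $\Lambda$-Fleming-Viot process, and $\mathscr B(\mathbb D)$ the Borel sigma-field of $\mathbb D$ augmented with the $\mathbf P$-null sets. The set $$\mathcal O=\{\rho\in\mathbb D:\ \rho\text{ admits an infinite sequence of Eves}\}$$ belongs to $\mathscr B(\mathbb D)$. Moreover the map $\mathbb D\cap\mathcal O\to[0,1]^{\mathbb N}$, $\rho\mapsto(\mathrm e^i)_{i\ge1}$, is measurable when $[0,1]^{\mathbb N}$ is endowed with the product sigma-field.
   Context: **$\Lambda$-Fleming-Viot process.** $\mathcal M_1$: probability measures on $[0,1]$, weak topology. With $\lambda_{m,k}=\int_{[0,1]}x^{k-2}(1-x)^{m-k}\Lambda(dx)$, $2\le k\le m$ ($0^0=1$), it is the $\mathcal M_1$-valued process (càdlàg), unique in law, started from Lebesgue measure, such that for all $n\ge1$ and continuous $f$ on $[0,1]^n$, $G_f(\rho_t)-\int_0^tLG_f(\rho_s)ds$ is a martingale, where $G_f(\mu)=\int f\,d\mu^{\otimes n}$, $LG_f(\mu)=\sum_{K\subset[n],k=\#K\ge2}\lambda_{n,k}\int\mu^{\otimes n}(dx)\,(f(R_K(x_1,\ldots,x_{n-k+1}))-f(x_1,\ldots,x_n))$, and $R_K(x_1,\ldots,x_{n-k+1})=(y_1,\ldots,y_n)$ with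 $y_i=x_{\min K}$ for $i\in K$ and the $y_i,i\notin K$, in increasing order of indices, equal to $x_1,\ldots,x_{\min K-1},x_{\min K+1},\ldots,x_{n-k+1}$. **Eves.** Let $\Psi(u)=\Lambda(\{0\})u^2+\int_{(0,1)}(e^{-xu}-1+xu)x^{-2}\Lambda(dx)$; regime CDI means $\int^\infty du/\Psi(u)<\infty$. If $\Lambda$ is not in regime CDI, $\rho$ admits an infinite sequence of Eves if there exists a collection $(\mathrm e^i)_{i\ge1}$ of points in $[0,1]$ such that for every $i\ge1$, $\rho_t(\{\mathrm e^i\})/\rho_t([0,1]\setminus\{\mathrm e^1,\ldots,\mathrm e^{i-1}\})\to1$ as $t\to\infty$. If $\Lambda$ is in regime CDI, $\rho$ admits an infinite sequence of Eves if one can order the atoms of $\rho$ by strictly decreasing extinction times, the sequence being then denoted $(\mathrm e^i)_{i\ge1}$; concretely, for all $t>0$ $\rho_t$ is a weighted sum of finitely many atoms, for $t,s>0$ the atoms of $\rho_{t+s}$ form a subset of the atoms of $\rho_t$, and the number $\#\rho_t$ of atoms is a càdlàg function of $t\in(0,\infty)$ making only jumps of size $-1$; the atoms are listed as $\mathrm e^1,\mathrm e^2,\ldots$ in decreasing order of their extinction times. *)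

theory Defs
  imports "HOL-Probability.Probability"
begin

section \<open>Probability measures on the unit interval and the weak topology\<close>

definition unit_borel :: "real measure" where
  "unit_borel = restrict_space borel {0..1}"

definition M1 :: "real measure set" where
  "M1 = space (prob_algebra unit_borel)"

definition weak_topology :: "real measure topology" where
  "weak_topology = topology_generated_by
     {{\<mu> \<in> M1. (\<integral>x. f x \<partial>\<mu>) \<in> U} | (f :: real \<Rightarrow> real) (U :: real set).
        continuous_on {0..1} f \<and> open U}"

definition borel_of :: "'a topology \<Rightarrow> 'a measure" where
  "borel_of X = sigma (topspace X) {U. openin X U}"


section \<open>Cadlag paths and the Skorohod topology\<close>

text \<open>
  At a point \<open>t\<close> of \<open>I\<close> with nothing of \<open>I\<close> to its left, the filter in the second conjunct is
  trivial, and that conjunct only says that the space is nonempty.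
\<close>

definition cadlag_on :: "real set \<Rightarrow> 'a topology \<Rightarrow> (real \<Rightarrow> 'a) \<Rightarrow> bool" where
  "cadlag_on I X f \<longleftrightarrow>
     (\<forall>t\<in>I. limitin X f (f t) (at t within I \<inter> {t<..}) \<and>
            (\<exists>l. limitin X f l (at t within I \<inter> {..<t})))"

definition skorohod_space :: "(real \<Rightarrow> real measure) set" where
  "skorohod_space = {\<rho> \<in> {0..} \<rightarrow>\<^sub>E M1. cadlag_on {0..} weak_topology \<rho>}"

definition time_changes :: "(real \<Rightarrow> real) set" where
  "time_changes = {\<tau>. bij_betw \<tau> {0..} {0..} \<and> strict_mono_on {0..} \<tau>}"

text \<open>
  Convergence in the Skorohod (J1) topology on the half-line: there are time changes
  \<open>\<tau>\<^sub>n\<close> with \<open>\<tau>\<^sub>n(s) - s\<close> tending to \<open>0\<close> uniformly in \<open>s\<close>, such that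
  \<open>r\<^sub>n(\<tau>\<^sub>n(s))\<close> tends to \<open>\<rho>(s)\<close> uniformly on every \<open>[0, T]\<close> (Jacod and Shiryaev, Theorem VI.1.14).
  Since \<open>M1\<close> is compact and metrizable, uniform convergence for a metric of the weak topology does
  not depend on the metric, and it is the same as uniform convergence of the integral of each
  continuous function.
\<close>

definition skorohod_conv :: "(nat \<Rightarrow> real \<Rightarrow> real measure) \<Rightarrow> (real \<Rightarrow> real measure) \<Rightarrow> bool" where
  "skorohod_conv r \<rho> \<longleftrightarrow>
     (\<exists>\<tau>. (\<forall>n. \<tau> n \<in> time_changes) \<and>
          uniform_limit {0..} \<tau> (\<lambda>s. s) sequentially \<and>
          (\<forall>T f. continuous_on {0..1} f \<longrightarrow>
             uniform_limit {0..T} (\<lambda>n s. \<integral>x. f x \<partial>(r n (\<tau> n s))) (\<lambda>s. \<integral>x. (f x :: real) \<partial>(\<rho> s))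
               sequentially))"

text \<open>
  The Skorohod topology is metrizable, so its open sets are exactly the sequentially open sets for
  the convergence above.
\<close>

definition skorohod_open :: "(real \<Rightarrow> real measure) set \<Rightarrow> bool" where
  "skorohod_open U \<longleftrightarrow> U \<subseteq> skorohod_space \<and>
     (\<forall>\<rho>\<in>U. \<forall>r. (\<forall>n. r n \<in> skorohod_space) \<and> skorohod_conv r \<rho> \<longrightarrow>
        eventually (\<lambda>n. r n \<in> U) sequentially)"

definition skorohod_topology :: "(real \<Rightarrow> real measure) topology" where
  "skorohod_topology = topology skorohod_open"

lemma topspace_weak_topology: "topspace weak_topology = M1"
proof -
  have "M1 \<in> {{\<mu> \<in> M1. (\<integral>x. f x \<partial>\<mu>) \<in> U} | (f :: real \<Rightarrow> real) (U :: real set).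
        continuous_on {0..1} f \<and> open U}"
    by (rule CollectI, rule exI[of _ "\<lambda>_. 0"], rule exI[of _ UNIV]) auto
  then show ?thesis
    unfolding weak_topology_def topology_generated_by_topspace by blast
qed

lemma openin_skorohod_topology: "openin skorohod_topology U \<longleftrightarrow> skorohod_open U"
proof -
  have "istopology skorohod_open"
    unfolding istopology_def
  proof (intro conjI allI impI)
    fix S T assume "skorohod_open S" "skorohod_open T"
    then show "skorohod_open (S \<inter> T)"
      unfolding skorohod_open_def by (auto intro: eventually_conj)
  next
    fix K assume K: "\<forall>S\<in>K. skorohod_open S"
    show "skorohod_open (\<Union>K)"
      unfolding skorohod_open_def
    proof (intro conjI ballI allI impI)
      show "\<Union>K \<subseteq> skorohod_space" using K by (auto simp: skorohod_open_def)
      fix \<rho> r assume "\<rho> \<in> \<Union>K" and r: "(\<forall>n. r n \<in> skorohod_space) \<and> skorohod_conv r \<rho>"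
      then obtain S where S: "S \<in> K" "\<rho> \<in> S" by blast
      then have "eventually (\<lambda>n. r n \<in> S) sequentially"
        using K r by (auto simp: skorohod_open_def)
      then show "eventually (\<lambda>n. r n \<in> \<Union>K) sequentially"
        by (rule eventually_mono) (use S in blast)
    qed
  qed
  then show ?thesis by (simp add: skorohod_topology_def topology_inverse')
qed

lemma topspace_skorohod_topology: "topspace skorohod_topology = skorohod_space"
proof -
  have "skorohod_open skorohod_space" by (simp add: skorohod_open_def)
  moreover have "U \<subseteq> skorohod_space" if "skorohod_open U" for U
    using that by (simp add: skorohod_open_def)
  ultimately show ?thesis
    unfolding topspace_def openin_skorohod_topology by auto
qed


section \<open>The Lambda-Fleming-Viot process\<close>

definition coal_rate :: "real measure \<Rightarrow> nat \<Rightarrow> nat \<Rightarrow> real" where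
  "coal_rate \<Lambda> m k = (\<integral>x. x ^ (k - 2) * (1 - x) ^ (m - k) \<partial>\<Lambda>)"

text \<open>
  Points of \<open>[0,1]\<^sup>n\<close> are functions on \<open>{1..n}\<close>. An index \<open>i\<close> outside \<open>K\<close> is the \<open>r\<close>-th
  element of \<open>{1..n} - K\<close>, and receives the \<open>r\<close>-th term of the sequence
  \<open>x 1, x 2, \<dots>\<close> from which \<open>x (Min K)\<close> has been deleted.
\<close>

definition reprod :: "nat \<Rightarrow> nat set \<Rightarrow> (nat \<Rightarrow> real) \<Rightarrow> nat \<Rightarrow> real" where
  "reprod n K x = (\<lambda>i\<in>{1..n}.
     if i \<in> K then x (Min K)
     else let r = card ({1..i} - K) in if r < Min K then x r else x (Suc r))"

definition G_fun :: "nat \<Rightarrow> ((nat \<Rightarrow> real) \<Rightarrow> real) \<Rightarrow> real measure \<Rightarrow> real" where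
  "G_fun n f \<mu> = (\<integral>x. f x \<partial>(PiM {1..n} (\<lambda>_. \<mu>)))"

definition LG_fun :: "real measure \<Rightarrow> nat \<Rightarrow> ((nat \<Rightarrow> real) \<Rightarrow> real) \<Rightarrow> real measure \<Rightarrow> real" where
  "LG_fun \<Lambda> n f \<mu> = (\<Sum>K | K \<subseteq> {1..n} \<and> 2 \<le> card K.
     coal_rate \<Lambda> n (card K) * (\<integral>x. f (reprod n K x) - f x \<partial>(PiM {1..n} (\<lambda>_. \<mu>))))"

definition natural_filtration ::
  "'w measure \<Rightarrow> ('w \<Rightarrow> real \<Rightarrow> real measure) \<Rightarrow> real \<Rightarrow> 'w measure" where
  "natural_filtration M X t = sigma (space M)
     {(\<lambda>\<omega>. X \<omega> s) -` A \<inter> space M | s A. 0 \<le> s \<and> s \<le> t \<and> A \<in> sets (borel_of weak_topology)}"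

definition martingale ::
  "'w measure \<Rightarrow> (real \<Rightarrow> 'w measure) \<Rightarrow> (real \<Rightarrow> 'w \<Rightarrow> real) \<Rightarrow> bool" where
  "martingale M F Z \<longleftrightarrow>
     (\<forall>t\<ge>0. subalgebra M (F t) \<and> Z t \<in> borel_measurable (F t) \<and> integrable M (Z t)) \<and>
     (\<forall>s t. 0 \<le> s \<and> s \<le> t \<longrightarrow> (AE \<omega> in M. real_cond_exp M (F s) (Z t) \<omega> = Z s \<omega>))"

definition Lambda_Fleming_Viot ::
  "real measure \<Rightarrow> 'w measure \<Rightarrow> ('w \<Rightarrow> real \<Rightarrow> real measure) \<Rightarrow> bool" where
  "Lambda_Fleming_Viot \<Lambda> M X \<longleftrightarrow>
     prob_space M \<and>
     X \<in> measurable M (borel_of skorohod_topology) \<and>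
     (AE \<omega> in M. X \<omega> 0 = restrict_space lborel {0..1}) \<and>
     (\<forall>n\<ge>1. \<forall>f. continuous_on ({1..n} \<rightarrow>\<^sub>E {0..1}) f \<longrightarrow>
        martingale M (natural_filtration M X)
          (\<lambda>t \<omega>. G_fun n f (X \<omega> t) - (LINT s:{0..t}|lborel. LG_fun \<Lambda> n f (X \<omega> s))))"


section \<open>Eves\<close>

definition Psi :: "real measure \<Rightarrow> real \<Rightarrow> real" where
  "Psi \<Lambda> u = measure \<Lambda> {0} * u\<^sup>2
     + (LINT x:{0<..<1}|\<Lambda>. (exp (- x * u) - 1 + x * u) / x\<^sup>2)"

text \<open>
  The quotient is taken in the extended nonnegative reals, so that it is infinite where \<open>Psi \<Lambda>\<close>
  vanishes.
\<close>

definition CDI :: "real measure \<Rightarrow> bool" where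
  "CDI \<Lambda> \<longleftrightarrow> (\<exists>a>0. (\<integral>\<^sup>+u\<in>{a..}. 1 / ennreal (Psi \<Lambda> u) \<partial>lborel) < \<infinity>)"

definition atoms :: "real measure \<Rightarrow> real set" where
  "atoms \<mu> = {a \<in> {0..1}. measure \<mu> {a} > 0}"

definition finitely_atomic :: "real measure \<Rightarrow> bool" where
  "finitely_atomic \<mu> \<longleftrightarrow> finite (atoms \<mu>) \<and>
     (\<forall>B\<in>sets \<mu>. measure \<mu> B = (\<Sum>a\<in>atoms \<mu> \<inter> B. measure \<mu> {a}))"

definition extinction_time :: "(real \<Rightarrow> real measure) \<Rightarrow> real \<Rightarrow> ereal" where
  "extinction_time \<rho> a = Sup {ereal t | t. 0 < t \<and> a \<in> atoms (\<rho> t)}"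

text \<open>
  If the denominator vanishes for arbitrarily large \<open>t\<close>, the quotient (then \<open>0\<close>) does not tend
  to \<open>1\<close>.
\<close>

definition Eves_nonCDI :: "(real \<Rightarrow> real measure) \<Rightarrow> (nat \<Rightarrow> real) \<Rightarrow> bool" where
  "Eves_nonCDI \<rho> e \<longleftrightarrow>
     (\<forall>i\<ge>1. ((\<lambda>t. measure (\<rho> t) {e i} / measure (\<rho> t) ({0..1} - e ` {1..<i})) \<longlongrightarrow> 1) at_top)"

text \<open>
  The last conjunct is the ordering of all the atoms, by strictly decreasing extinction times, into
  an infinite sequence; in particular exactly one atom, \<open>e 1\<close>, may have infinite extinction time.
\<close>

definition Eves_CDI :: "(real \<Rightarrow> real measure) \<Rightarrow> (nat \<Rightarrow> real) \<Rightarrow> bool" where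
  "Eves_CDI \<rho> e \<longleftrightarrow>
     (\<forall>t>0. finitely_atomic (\<rho> t)) \<and>
     (\<forall>t>0. \<forall>s>0. atoms (\<rho> (t + s)) \<subseteq> atoms (\<rho> t)) \<and>
     cadlag_on {0<..} euclideanreal (\<lambda>t. real (card (atoms (\<rho> t)))) \<and>
     (\<forall>t>0. \<forall>l. ((\<lambda>s. real (card (atoms (\<rho> s)))) \<longlongrightarrow> l) (at_left t) \<longrightarrow>
        real (card (atoms (\<rho> t))) - l \<in> {0, -1}) \<and>
     (bij_betw e {1..} (\<Union>t\<in>{0<..}. atoms (\<rho> t)) \<and>
      (\<forall>i j. 1 \<le> i \<and> i < j \<longrightarrow> extinction_time \<rho> (e j) < extinction_time \<rho> (e i)))"

definition is_Eves :: "real measure \<Rightarrow> (real \<Rightarrow> real measure) \<Rightarrow> (nat \<Rightarrow> real) \<Rightarrow> bool" where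
  "is_Eves \<Lambda> \<rho> e \<longleftrightarrow> e \<in> {1..} \<rightarrow>\<^sub>E {0..1} \<and> (if CDI \<Lambda> then Eves_CDI \<rho> e else Eves_nonCDI \<rho> e)"

definition admits_Eves :: "real measure \<Rightarrow> (real \<Rightarrow> real measure) \<Rightarrow> bool" where
  "admits_Eves \<Lambda> \<rho> \<longleftrightarrow> (\<exists>e. is_Eves \<Lambda> \<rho> e)"

definition Eves :: "real measure \<Rightarrow> (real \<Rightarrow> real measure) \<Rightarrow> nat \<Rightarrow> real" where
  "Eves \<Lambda> \<rho> = (THE e. is_Eves \<Lambda> \<rho> e)"

text \<open>The sequence of Eves is unique when it exists, so the description defining \<open>Eves\<close> is proper.\<close>

lemma Eves_CDI_unique:
  assumes "Eves_CDI \<rho> e" "Eves_CDI \<rho> e'" "i \<ge> 1"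
  shows "e i = e' i"
  using assms(3)
proof (induction i rule: less_induct)
  case (less i)
  let ?A = "\<Union>t\<in>{0<..}. atoms (\<rho> t)" and ?d = "extinction_time \<rho>"
  have b: "bij_betw e {1..} ?A" "bij_betw e' {1..} ?A"
    and d: "\<And>i j. 1 \<le> i \<Longrightarrow> i < j \<Longrightarrow> ?d (e j) < ?d (e i)"
      "\<And>i j. 1 \<le> i \<Longrightarrow> i < j \<Longrightarrow> ?d (e' j) < ?d (e' i)"
    using assms(1,2) unfolding Eves_CDI_def by blast+
  have inj: "inj_on e {1..}" "inj_on e' {1..}" using b by (auto simp: bij_betw_def)
  have im: "e ` {1..} = ?A" "e' ` {1..} = ?A" using b by (auto simp: bij_betw_def)
  have "e i \<in> e' ` {1..}" "e' i \<in> e ` {1..}" using im less.prems by auto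
  then obtain k j where k: "k \<ge> 1" "e i = e' k" and j: "j \<ge> 1" "e' i = e j" by auto
  have ki: "i \<le> k"
  proof (rule ccontr)
    assume "\<not> i \<le> k"
    then have "e k = e i" using less.IH[of k] k by simp
    then show False using inj_onD[OF inj(1), of k i] k less.prems \<open>\<not> i \<le> k\<close> by simp
  qed
  have ji: "i \<le> j"
  proof (rule ccontr)
    assume "\<not> i \<le> j"
    then have "e' j = e' i" using less.IH[of j] j by simp
    then show False using inj_onD[OF inj(2), of j i] j less.prems \<open>\<not> i \<le> j\<close> by simp
  qed
  show ?case
  proof (rule ccontr)
    assume "e i \<noteq> e' i"
    then have "i < k" "i < j" using ki ji k j by (auto simp: le_less)
    then have "?d (e' k) < ?d (e' i)" "?d (e j) < ?d (e i)" using d less.prems by auto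
    then show False using k j by auto
  qed
qed

lemma M1_D:
  assumes "\<mu> \<in> M1"
  shows "prob_space \<mu>" "a \<in> {0..1} \<Longrightarrow> {a} \<in> sets \<mu>" "finite S \<Longrightarrow> {0..1} - S \<in> sets \<mu>"
proof -
  have s: "sets \<mu> = sets unit_borel" and "prob_space \<mu>"
    using assms by (auto simp: M1_def space_prob_algebra)
  then show "prob_space \<mu>" by simp
  show "{a} \<in> sets \<mu>" if "a \<in> {0..1}"
    unfolding s unit_borel_def using that by (subst sets_restrict_space_iff) auto
  show "{0..1} - S \<in> sets \<mu>" if "finite S"
    unfolding s unit_borel_def
    using sets.Diff[OF borel_closed borel_closed[OF finite_imp_closed[OF that]]]
    by (subst sets_restrict_space_iff) auto
qed

lemma Eves_nonCDI_aux:
  assumes E: "Eves_nonCDI \<rho> e" and \<rho>: "\<And>t. t \<ge> 0 \<Longrightarrow> \<rho> t \<in> M1"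
    and e: "e \<in> {1..} \<rightarrow>\<^sub>E {0..1}" and j: "1 \<le> j" "j < i" "e j \<notin> e ` {1..<j}"
    and lim: "((\<lambda>t. measure (\<rho> t) {a} / measure (\<rho> t) ({0..1} - e ` {1..<i})) \<longlongrightarrow> 1) at_top"
  shows "a \<noteq> e j"
proof
  assume a: "a = e j"
  let ?m = "\<lambda>k t. measure (\<rho> t) ({0..1} - e ` {1..<k})"
  have "((\<lambda>t. measure (\<rho> t) {e j} / ?m j t) \<longlongrightarrow> 1) at_top"
    using E j by (simp add: Eves_nonCDI_def)
  then have "eventually (\<lambda>t. measure (\<rho> t) {e j} / ?m j t > 3 / 4) at_top"
    by (rule order_tendstoD) simp
  moreover have "eventually (\<lambda>t. measure (\<rho> t) {a} / ?m i t > 3 / 4) at_top"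
    "eventually (\<lambda>t. measure (\<rho> t) {a} / ?m i t < 3 / 2) at_top"
    by (rule order_tendstoD[OF lim], simp)+
  ultimately have "eventually (\<lambda>t. t \<ge> 0 \<and> measure (\<rho> t) {e j} / ?m j t > 3 / 4 \<and>
      measure (\<rho> t) {a} / ?m i t > 3 / 4 \<and> measure (\<rho> t) {a} / ?m i t < 3 / 2) at_top"
    using eventually_ge_at_top[of "0::real"] by eventually_elim simp
  then obtain t where t: "t \<ge> 0" "measure (\<rho> t) {e j} / ?m j t > 3 / 4"
      "measure (\<rho> t) {a} / ?m i t > 3 / 4" "measure (\<rho> t) {a} / ?m i t < 3 / 2"
    using eventually_happens'[OF trivial_limit_at_top_linorder] by blast
  interpret prob_space "\<rho> t" using M1_D(1)[OF \<rho>[OF t(1)]] .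
  have ej: "e j \<in> {0..1}" using e j by (auto simp: PiE_iff)
  note S = M1_D(2)[OF \<rho>[OF t(1)] ej] M1_D(3)[OF \<rho>[OF t(1)]]
  have "measure (\<rho> t) {e j} + ?m i t = measure (\<rho> t) ({e j} \<union> ({0..1} - e ` {1..<i}))"
    using S j by (subst finite_measure_Union) auto
  also have "\<dots> \<le> ?m j t"
    by (rule finite_measure_mono) (use ej j S in auto)
  finally have le: "measure (\<rho> t) {e j} + ?m i t \<le> ?m j t" .
  have "?m i t > 0" "?m j t > 0" using t by (auto simp: zero_less_measure_iff)
  then show False using le t a by (simp add: field_simps)
qed

lemma Eves_nonCDI_distinct:
  assumes E: "Eves_nonCDI \<rho> e" and \<rho>: "\<And>t. t \<ge> 0 \<Longrightarrow> \<rho> t \<in> M1"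
    and e: "e \<in> {1..} \<rightarrow>\<^sub>E {0..1}" and "i \<ge> 1"
  shows "e i \<notin> e ` {1..<i}"
  using assms(4)
proof (induction i rule: less_induct)
  case (less i)
  have "e i \<noteq> e j" if "j \<in> {1..<i}" for j
    using Eves_nonCDI_aux[OF E \<rho> e, of j i "e i"] that less E by (auto simp: Eves_nonCDI_def)
  then show ?case by blast
qed

lemma Eves_nonCDI_unique:
  assumes E: "Eves_nonCDI \<rho> e" "Eves_nonCDI \<rho> e'" and \<rho>: "\<And>t. t \<ge> 0 \<Longrightarrow> \<rho> t \<in> M1"
    and e: "e \<in> {1..} \<rightarrow>\<^sub>E {0..1}" "e' \<in> {1..} \<rightarrow>\<^sub>E {0..1}" and "i \<ge> 1"
  shows "e i = e' i"
  using assms(6)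
proof (induction i rule: less_induct)
  case (less i)
  have eq: "e ` {1..<i} = e' ` {1..<i}"
    using less.IH by (intro image_cong) auto
  let ?m = "\<lambda>t. measure (\<rho> t) ({0..1} - e ` {1..<i})"
  have L: "((\<lambda>t. measure (\<rho> t) {e i} / ?m t) \<longlongrightarrow> 1) at_top"
    "((\<lambda>t. measure (\<rho> t) {e' i} / ?m t) \<longlongrightarrow> 1) at_top"
    using E less.prems eq by (auto simp: Eves_nonCDI_def)
  have "eventually (\<lambda>t. measure (\<rho> t) {e i} / ?m t > 3 / 4) at_top"
    "eventually (\<lambda>t. measure (\<rho> t) {e' i} / ?m t > 3 / 4) at_top"
    by (rule order_tendstoD[OF L(1)], simp) (rule order_tendstoD[OF L(2)], simp)
  then have "eventually (\<lambda>t. t \<ge> 0 \<and> measure (\<rho> t) {e i} / ?m t > 3 / 4 \<and>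
      measure (\<rho> t) {e' i} / ?m t > 3 / 4) at_top"
    using eventually_ge_at_top[of "0::real"] by eventually_elim simp
  then obtain t where t: "t \<ge> 0" "measure (\<rho> t) {e i} / ?m t > 3 / 4"
      "measure (\<rho> t) {e' i} / ?m t > 3 / 4"
    using eventually_happens'[OF trivial_limit_at_top_linorder] by blast
  interpret prob_space "\<rho> t" using M1_D(1)[OF \<rho>[OF t(1)]] .
  have I: "e i \<in> {0..1}" "e' i \<in> {0..1}" using e less.prems by (auto simp: PiE_iff)
  note S = M1_D(2)[OF \<rho>[OF t(1)] I(1)] M1_D(2)[OF \<rho>[OF t(1)] I(2)] M1_D(3)[OF \<rho>[OF t(1)]]
  have n: "e i \<notin> e ` {1..<i}" "e' i \<notin> e ` {1..<i}"
    using Eves_nonCDI_distinct[OF E(1) \<rho> e(1) less.prems]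
      Eves_nonCDI_distinct[OF E(2) \<rho> e(2) less.prems] eq by auto
  show ?case
  proof (rule ccontr)
    assume "e i \<noteq> e' i"
    then have "measure (\<rho> t) {e i} + measure (\<rho> t) {e' i} = measure (\<rho> t) ({e i} \<union> {e' i})"
      using S by (subst finite_measure_Union) auto
    also have "\<dots> \<le> ?m t"
      by (rule finite_measure_mono) (use I n S in auto)
    finally have le: "measure (\<rho> t) {e i} + measure (\<rho> t) {e' i} \<le> ?m t" .
    have "?m t > 0" using t by (auto simp: zero_less_measure_iff)
    then show False using le t by (simp add: field_simps)
  qed
qed

lemma Eves_eq:
  assumes "\<rho> \<in> skorohod_space" "is_Eves \<Lambda> \<rho> e"
  shows "Eves \<Lambda> \<rho> = e"
  unfolding Eves_def
proof (rule the_equality)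
  fix e' assume e': "is_Eves \<Lambda> \<rho> e'"
  have \<rho>: "\<And>t. t \<ge> 0 \<Longrightarrow> \<rho> t \<in> M1" using assms(1) by (auto simp: skorohod_space_def PiE_iff)
  have "e' i = e i" if "i \<in> {1..}" for i
    using assms(2) e' that Eves_CDI_unique[of \<rho> e' e i] Eves_nonCDI_unique[of \<rho> e' e i] \<rho>
    by (auto simp: is_Eves_def split: if_splits)
  then show "e' = e"
    using assms(2) e' by (intro PiE_ext[of e' "{1..}" "\<lambda>_. {0..1}" e]) (auto simp: is_Eves_def)
qed (fact assms(2))

end

theory Submission
  imports Defs
begin

text \<open>
  Open subsets of the Skorohod space detect excursions
  \<open>\<exists>s\<in>(a, b). \<integral>f d\<rho>\<^sub>s > c\<close>, so by right-continuity the path is jointly measurable in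
  \<open>(\<rho>, t)\<close>. The conditions defining the Eves then quantify jointly measurable predicates over
  uncountable sets of times and positions. Such quantifiers lead out of the Borel sets, but they
  preserve measurability with respect to a complete finite measure, by the measurable projection
  theorem; this is where the augmentation by null sets is needed. Outside regime CDI the Eves are
  found one after the other, each as the only point whose mass, relative to what the earlier ones
  leave over, tends to \<open>1\<close> along the integer times. In regime CDI, \<open>e\<^sup>i\<close> is the atom present when
  there are \<open>i\<close> atoms and absent when there are \<open>i - 1\<close>.
\<close>

section \<open>The Souslin operation and measurable projection\<close>

text \<open>The projection theorem joins two facts. Souslin sets built from rectangles with a
  compact second side project to Souslin sets, by the finite intersection property; Souslin sets
  built from measurable sets are measurable for a complete finite measure, because outer measure is
  approximated from inside. To use it, each condition must become a quantifier over a Euclidean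
  space applied to a jointly measurable predicate. Three obstacles stand in the way. Evaluation at a
  fixed time is not continuous in the J1 topology, hence the detour through excursions over open
  time intervals. The Eves are given by a description operator; uniqueness turns "the selected point
  lies in \<open>B\<close>" into "some candidate lies in \<open>B\<close>". Finite atomicity
  quantifies over all Borel sets, which no projection handles; it is replaced by a countable
  condition, that \<open>n\<close> but not \<open>n + 1\<close> disjoint rational intervals can be
  charged.\<close>

definition finitely_determined :: "((nat \<Rightarrow> nat) \<Rightarrow> 'a) \<Rightarrow> bool" where
  "finitely_determined h \<longleftrightarrow> (\<forall>\<sigma>. \<exists>N. \<forall>\<sigma>'. (\<forall>k<N. \<sigma>' k = \<sigma> k) \<longrightarrow> h \<sigma>' = h \<sigma>)"

lemma finitely_determinedD:
  "finitely_determined h \<Longrightarrow> \<exists>N. \<forall>\<sigma>'. (\<forall>k<N. \<sigma>' k = \<sigma> k) \<longrightarrow> h \<sigma>' = h \<sigma>"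
  by (simp add: finitely_determined_def)

lemma finitely_determined_const: "finitely_determined (\<lambda>\<sigma>. a)"
  by (simp add: finitely_determined_def)

lemma finitely_determined_reindex:
  assumes "finitely_determined h"
  shows "finitely_determined (\<lambda>\<sigma>. h (\<lambda>k. \<sigma> (\<pi> k)))"
  unfolding finitely_determined_def
proof
  fix \<sigma> :: "nat \<Rightarrow> nat"
  obtain N where N: "\<forall>\<sigma>'. (\<forall>k<N. \<sigma>' k = \<sigma> (\<pi> k)) \<longrightarrow> h \<sigma>' = h (\<lambda>k. \<sigma> (\<pi> k))"
    using finitely_determinedD[OF assms, of "\<lambda>k. \<sigma> (\<pi> k)"] ..
  \<comment> \<open>The sum dominates each \<open>\<pi> k\<close> with \<open>k < N\<close>, so a
    prefix of length \<open>Suc (sum \<pi> {..<N})\<close> contains all the coordinates that are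
    read.\<close>
  have le: "\<pi> k \<le> sum \<pi> {..<N}" if "k < N" for k
    using that by (intro member_le_sum) auto
  show "\<exists>N'. \<forall>\<sigma>'. (\<forall>k<N'. \<sigma>' k = \<sigma> k) \<longrightarrow> h (\<lambda>k. \<sigma>' (\<pi> k)) = h (\<lambda>k. \<sigma> (\<pi> k))"
  proof (intro exI allI impI)
    fix \<sigma>' assume "\<forall>k<Suc (sum \<pi> {..<N}). \<sigma>' k = \<sigma> k"
    then have "\<forall>k<N. \<sigma>' (\<pi> k) = \<sigma> (\<pi> k)" using le by (simp add: less_Suc_eq_le)
    then show "h (\<lambda>k. \<sigma>' (\<pi> k)) = h (\<lambda>k. \<sigma> (\<pi> k))"
      using N[rule_format, of "\<lambda>k. \<sigma>' (\<pi> k)"] by metis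
  qed
qed

text \<open>The prefix length may depend on the sequence, so it can first look at
  \<open>\<sigma> 0\<close> and then use the bound belonging to the scheme selected there.\<close>

lemma finitely_determined_head:
  assumes "\<And>i. finitely_determined (h i)"
  shows "finitely_determined (\<lambda>\<sigma>. h (\<sigma> 0) (\<lambda>k. \<sigma> (Suc k)))"
  unfolding finitely_determined_def
proof
  fix \<sigma> :: "nat \<Rightarrow> nat"
  obtain N where N: "\<forall>\<sigma>'. (\<forall>k<N. \<sigma>' k = \<sigma> (Suc k)) \<longrightarrow>
      h (\<sigma> 0) \<sigma>' = h (\<sigma> 0) (\<lambda>k. \<sigma> (Suc k))"
    using finitely_determinedD[OF assms, of "\<lambda>k. \<sigma> (Suc k)" "\<sigma> 0"] ..
  show "\<exists>N'. \<forall>\<sigma>'. (\<forall>k<N'. \<sigma>' k = \<sigma> k) \<longrightarrow>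
      h (\<sigma>' 0) (\<lambda>k. \<sigma>' (Suc k)) = h (\<sigma> 0) (\<lambda>k. \<sigma> (Suc k))"
  proof (intro exI allI impI)
    fix \<sigma>' assume "\<forall>k<Suc N. \<sigma>' k = \<sigma> k"
    then have "\<forall>k<N. \<sigma>' (Suc k) = \<sigma> (Suc k)" "\<sigma>' 0 = \<sigma> 0" by auto
    then show "h (\<sigma>' 0) (\<lambda>k. \<sigma>' (Suc k)) = h (\<sigma> 0) (\<lambda>k. \<sigma> (Suc k))"
      using N[rule_format, of "\<lambda>k. \<sigma>' (Suc k)"] by metis
  qed
qed

lemma finitely_determined_map2:
  assumes "finitely_determined h" "finitely_determined h'"
  shows "finitely_determined (\<lambda>\<sigma>. g (h \<sigma>) (h' \<sigma>))"
  unfolding finitely_determined_def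
proof
  fix \<sigma> :: "nat \<Rightarrow> nat"
  obtain N where N: "\<forall>\<sigma>'. (\<forall>k<N. \<sigma>' k = \<sigma> k) \<longrightarrow> h \<sigma>' = h \<sigma>"
    using finitely_determinedD[OF assms(1), of \<sigma>] ..
  obtain N' where N': "\<forall>\<sigma>'. (\<forall>k<N'. \<sigma>' k = \<sigma> k) \<longrightarrow> h' \<sigma>' = h' \<sigma>"
    using finitely_determinedD[OF assms(2), of \<sigma>] ..
  show "\<exists>M. \<forall>\<sigma>'. (\<forall>k<M. \<sigma>' k = \<sigma> k) \<longrightarrow> g (h \<sigma>') (h' \<sigma>') = g (h \<sigma>) (h' \<sigma>)"
  proof (intro exI allI impI)
    fix \<sigma>' assume "\<forall>k<max N N'. \<sigma>' k = \<sigma> k"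
    then have "h \<sigma>' = h \<sigma>" "h' \<sigma>' = h' \<sigma>"
      using N[rule_format, of \<sigma>'] N'[rule_format, of \<sigma>'] by auto
    then show "g (h \<sigma>') (h' \<sigma>') = g (h \<sigma>) (h' \<sigma>)" by simp
  qed
qed

lemma finitely_determined_INT:
  assumes "\<And>n. finitely_determined (h n)"
  shows "finitely_determined (\<lambda>\<sigma>. \<Inter>j\<le>n. h (j::nat) \<sigma>)"
proof (induction n)
  case 0
  show ?case using assms[of 0] by simp
next
  case (Suc n)
  have "(\<lambda>\<sigma>. \<Inter>j\<le>Suc n. h j \<sigma>) = (\<lambda>\<sigma>. h (Suc n) \<sigma> \<inter> (\<Inter>j\<le>n. h j \<sigma>))"
    by (simp add: atMost_Suc)
  then show ?case
    by (simp only:) (rule finitely_determined_map2[OF assms Suc.IH])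
qed

text \<open>This is the Souslin operation. Classically level \<open>n\<close> is indexed by the
  first \<open>n\<close> terms of \<open>\<sigma>\<close>; here it may depend on any finite prefix,
  of a length varying with \<open>\<sigma>\<close>, so \<open>G n\<close> is a continuous map from
  Baire space to a discrete space. This freedom makes reindexing of the parameter harmless in the
  closure proofs.\<close>

definition souslin_sets :: "'a set set \<Rightarrow> 'a set set" where
  "souslin_sets \<P> = {\<Union>\<sigma>. \<Inter>n. G n \<sigma> | G :: nat \<Rightarrow> (nat \<Rightarrow> nat) \<Rightarrow> 'a set.
     \<forall>n. finitely_determined (G n) \<and> (\<forall>\<sigma>. G n \<sigma> \<in> \<P>)}"

lemma souslin_setsI:
  assumes "\<And>n. finitely_determined (G n)" "\<And>n \<sigma>. G n \<sigma> \<in> \<P>" "A = (\<Union>\<sigma>. \<Inter>n::nat. G n \<sigma>)"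
  shows "A \<in> souslin_sets \<P>"
  unfolding souslin_sets_def using assms by (intro CollectI exI[of _ G] conjI allI)

lemma souslin_setsD:
  "A \<in> souslin_sets \<P> \<Longrightarrow>
    \<exists>G. (\<forall>n. finitely_determined (G n)) \<and> (\<forall>n \<sigma>. G n \<sigma> \<in> \<P>) \<and> A = (\<Union>\<sigma>. \<Inter>n::nat. G n \<sigma>)"
  unfolding souslin_sets_def by (elim CollectE exE conjE) (auto intro!: exI)

lemma souslin_sets_basic: "A \<in> \<P> \<Longrightarrow> A \<in> souslin_sets \<P>"
  by (rule souslin_setsI[of "\<lambda>_ _. A"]) (simp_all add: finitely_determined_const)

text \<open>The index of the set is stored in front of the parameter: \<open>\<sigma> 0\<close>
  picks \<open>i\<close>, and the shifted sequence is the parameter for \<open>A i\<close>.\<close>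

lemma souslin_sets_UN:
  assumes "\<And>i::nat. A i \<in> souslin_sets \<P>"
  shows "(\<Union>i. A i) \<in> souslin_sets \<P>"
proof -
  obtain G where "\<forall>i. (\<forall>n. finitely_determined (G i n)) \<and> (\<forall>n \<sigma>. G i n \<sigma> \<in> \<P>) \<and>
      A i = (\<Union>\<sigma>. \<Inter>n::nat. G i n \<sigma>)"
    using choice[OF allI[OF souslin_setsD[OF assms]]] ..
  then have G: "\<And>i n. finitely_determined (G i n)" "\<And>i n \<sigma>. G i n \<sigma> \<in> \<P>"
    "\<And>i. A i = (\<Union>\<sigma>. \<Inter>n. G i n \<sigma>)"
    by blast+
  show ?thesis
  proof (rule souslin_setsI)
    show "finitely_determined (\<lambda>\<sigma>. G (\<sigma> 0) n (\<lambda>k. \<sigma> (Suc k)))" for n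
      by (rule finitely_determined_head) (rule G)
    show "G (\<sigma> 0) n (\<lambda>k. \<sigma> (Suc k)) \<in> \<P>" for n \<sigma> by (rule G)
    show "(\<Union>i. A i) = (\<Union>\<sigma>. \<Inter>n. G (\<sigma> 0) n (\<lambda>k. \<sigma> (Suc k)))"
    proof (intro equalityI subsetI)
      fix x assume "x \<in> (\<Union>i. A i)"
      then obtain i \<sigma> where "\<And>n. x \<in> G i n \<sigma>" by (auto simp: G(3))
      then have "\<forall>n. x \<in> G (case_nat i \<sigma> 0) n (\<lambda>k. case_nat i \<sigma> (Suc k))" by simp
      then show "x \<in> (\<Union>\<sigma>. \<Inter>n. G (\<sigma> 0) n (\<lambda>k. \<sigma> (Suc k)))" by blast
    next
      fix x assume "x \<in> (\<Union>\<sigma>. \<Inter>n. G (\<sigma> 0) n (\<lambda>k. \<sigma> (Suc k)))"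
      then obtain \<sigma> where "x \<in> (\<Inter>n. G (\<sigma> 0) n (\<lambda>k. \<sigma> (Suc k)))" by blast
      then have "x \<in> A (\<sigma> 0)" unfolding G(3) by blast
      then show "x \<in> (\<Union>i. A i)" by blast
    qed
  qed
qed

text \<open>Through the pairing of naturals one sequence codes a sequence of sequences, one
  parameter for each \<open>i\<close>; the conditions for all \<open>i\<close> and \<open>n\<close>
  are likewise listed by the single index \<open>m\<close>.\<close>

lemma souslin_sets_INT:
  assumes "\<And>i::nat. A i \<in> souslin_sets \<P>"
  shows "(\<Inter>i. A i) \<in> souslin_sets \<P>"
proof -
  obtain G where "\<forall>i. (\<forall>n. finitely_determined (G i n)) \<and> (\<forall>n \<sigma>. G i n \<sigma> \<in> \<P>) \<and>
      A i = (\<Union>\<sigma>. \<Inter>n::nat. G i n \<sigma>)"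
    using choice[OF allI[OF souslin_setsD[OF assms]]] ..
  then have G: "\<And>i n. finitely_determined (G i n)" "\<And>i n \<sigma>. G i n \<sigma> \<in> \<P>"
    "\<And>i. A i = (\<Union>\<sigma>. \<Inter>n. G i n \<sigma>)"
    by blast+
  let ?H = "\<lambda>m \<sigma>. G (fst (prod_decode m)) (snd (prod_decode m)) (\<lambda>k. \<sigma> (prod_encode (fst (prod_decode m), k)))"
  show ?thesis
  proof (rule souslin_setsI)
    show "finitely_determined (?H m)" for m
      by (rule finitely_determined_reindex) (rule G)
    show "?H m \<sigma> \<in> \<P>" for m \<sigma> by (rule G)
    show "(\<Inter>i. A i) = (\<Union>\<sigma>. \<Inter>m. ?H m \<sigma>)"
    proof (intro equalityI subsetI)
      fix x assume "x \<in> (\<Inter>i. A i)"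
      then have "\<forall>i. \<exists>\<sigma>. \<forall>n. x \<in> G i n \<sigma>" by (auto simp: G(3))
      then obtain \<sigma> where s: "\<And>i n. x \<in> G i n (\<sigma> i)" by metis
      define \<tau> where "\<tau> m = \<sigma> (fst (prod_decode m)) (snd (prod_decode m))" for m
      have "x \<in> ?H m \<tau>" for m using s by (simp add: \<tau>_def)
      then show "x \<in> (\<Union>\<sigma>. \<Inter>m. ?H m \<sigma>)" by blast
    next
      fix x assume "x \<in> (\<Union>\<sigma>. \<Inter>m. ?H m \<sigma>)"
      then obtain \<tau> where t: "\<And>m. x \<in> ?H m \<tau>" by blast
      have "x \<in> A i" for i
      proof -
        have "x \<in> G i n (\<lambda>k. \<tau> (prod_encode (i, k)))" for n
          using t[of "prod_encode (i, n)"] by simp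
        then show ?thesis unfolding G(3) by blast
      qed
      then show "x \<in> (\<Inter>i. A i)" by blast
    qed
  qed
qed

section \<open>Measurability of Souslin sets for a complete finite measure\<close>

text \<open>Compactness of a product of finite sets, by repeated pigeonhole choices along infinite
  index sets and a diagonal sequence. Coordinate \<open>j\<close> is bounded only in the sequences
  \<open>s k\<close> with \<open>k > j\<close>; this leaves out finitely many terms and does not
  affect cluster points.\<close>

lemma bounded_sequences_cluster:
  fixes s :: "nat \<Rightarrow> nat \<Rightarrow> nat" and b :: "nat \<Rightarrow> nat"
  assumes "\<And>k j. j < k \<Longrightarrow> s k j \<le> b j"
  shows "\<exists>\<sigma>. \<forall>k m. \<exists>m'\<ge>m. \<forall>j<k. s m' j = \<sigma> j"
proof -
  let ?P = "\<lambda>k \<sigma>. infinite {m. \<forall>j<k. s m j = \<sigma> j}"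
  have "\<exists>f. \<forall>k. ?P k (f k) \<and> (\<forall>j<k. f (Suc k) j = f k j)"
  proof (rule dependent_nat_choice)
    show "\<exists>\<sigma>. ?P 0 \<sigma>" by simp
  next
    fix \<sigma> :: "nat \<Rightarrow> nat" and k assume P: "?P k \<sigma>"
    \<comment> \<open>The bound on coordinate \<open>k\<close> is available only in
      \<open>s m\<close> with \<open>m > k\<close>, hence the removal of
      \<open>{..k}\<close>.\<close>
    let ?A = "{m. \<forall>j<k. s m j = \<sigma> j} - {..k}"
    have A: "infinite ?A" using P by (simp add: Diff_infinite_finite)
    have "(\<lambda>m. s m k) ` ?A \<subseteq> {..b k}" by (auto intro!: assms)
    then have "finite ((\<lambda>m. s m k) ` ?A)" by (rule finite_subset) simp
    from pigeonhole_infinite[OF A this] obtain a where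
      a: "infinite {m \<in> ?A. s m k = s a k}" by blast
    have "{m \<in> ?A. s m k = s a k} \<subseteq> {m. \<forall>j<Suc k. s m j = (\<sigma>(k := s a k)) j}"
      by (auto simp: less_Suc_eq)
    then have "?P (Suc k) (\<sigma>(k := s a k))" using a finite_subset by blast
    then show "\<exists>\<sigma>'. ?P (Suc k) \<sigma>' \<and> (\<forall>j<k. \<sigma>' j = \<sigma> j)"
      by (intro exI[of _ "\<sigma>(k := s a k)"]) simp
  qed
  then obtain f where f: "\<And>k. ?P k (f k)" "\<And>k j. j < k \<Longrightarrow> f (Suc k) j = f k j" by blast
  define \<sigma> where "\<sigma> j = f (Suc j) j" for j
  have eq: "f k j = \<sigma> j" if "j < k" for k j
    using that
  proof (induction k)
    case (Suc k)
    then show ?case using f(2)[of j k] by (cases "j = k") (auto simp: \<sigma>_def)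
  qed simp
  have "\<exists>m'\<ge>m. \<forall>j<k. s m' j = \<sigma> j" for k m
  proof -
    obtain m' where "m' \<ge> m" "m' \<in> {m. \<forall>j<k. s m j = f k j}"
      using f(1)[of k] unfolding infinite_nat_iff_unbounded_le by blast
    then show ?thesis using eq by (intro exI[of _ m']) auto
  qed
  then show ?thesis by blast
qed

text \<open>
  Choquet's argument: bounding the coordinates of the parameter one after the other, by bounds so
  large that the outer measure stays above \<open>c\<close>, leaves a compact set of parameters, over which the
  union of intersections is a countable intersection of finite unions.
\<close>

lemma souslin_inner_approximation:
  assumes fin: "finite_measure M"
    and G: "\<And>n. finitely_determined (G n)" "\<And>n \<sigma>. G n \<sigma> \<in> sets M"
    and c: "c < outer_measure_of M (\<Union>\<sigma>. \<Inter>n::nat. G n \<sigma>)"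
  shows "\<exists>B\<in>sets M. B \<subseteq> (\<Union>\<sigma>. \<Inter>n::nat. G n \<sigma>) \<and> c \<le> emeasure M B"
proof -
  \<comment> \<open>The part of the union that is left when only the first \<open>k\<close>
    coordinates are bounded; \<open>T 0 b\<close> is the whole union.\<close>
  define T where "T k b = (\<Union>\<sigma>\<in>{\<sigma>. \<forall>j<k. \<sigma> j \<le> b j}. \<Inter>n. G n \<sigma>)" for k and b :: "nat \<Rightarrow> nat"
  have Gs: "G n \<sigma> \<subseteq> space M" for n \<sigma> using sets.sets_into_space[OF G(2)] .
  have Ts: "T k b \<subseteq> space M" for k b using Gs by (fastforce simp: T_def)
  have T_cong: "T k b = T k b'" if "\<And>j. j < k \<Longrightarrow> b j = b' j" for k b b'
    using that by (simp add: T_def)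
  have "\<exists>f. \<forall>k. c < outer_measure_of M (T k (f k)) \<and> (\<forall>j<k. f (Suc k) j = f k j)"
  proof (rule dependent_nat_choice)
    show "\<exists>b. c < outer_measure_of M (T 0 b)" using c by (simp add: T_def)
  next
    fix b k assume P: "c < outer_measure_of M (T k b)"
    have inc: "incseq (\<lambda>m. T (Suc k) (b(k := m)))"
    proof (rule incseq_SucI)
      fix m
      have "{\<sigma>. \<forall>j<Suc k. \<sigma> j \<le> (b(k := m)) j} \<subseteq> {\<sigma>. \<forall>j<Suc k. \<sigma> j \<le> (b(k := Suc m)) j}"
        by (auto simp: less_Suc_eq)
      then show "T (Suc k) (b(k := m)) \<le> T (Suc k) (b(k := Suc m))"
        unfolding T_def by (rule UN_mono) simp
    qed
    have "T k b \<subseteq> (\<Union>m. T (Suc k) (b(k := m)))"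
    proof
      fix x assume "x \<in> T k b"
      then obtain \<sigma> where s: "\<And>j. j < k \<Longrightarrow> \<sigma> j \<le> b j" "x \<in> (\<Inter>n. G n \<sigma>)"
        by (auto simp: T_def)
      then have "x \<in> T (Suc k) (b(k := \<sigma> k))" by (auto simp: T_def less_Suc_eq intro!: exI[of _ \<sigma>])
      then show "x \<in> (\<Union>m. T (Suc k) (b(k := m)))" by blast
    qed
    then have "c < outer_measure_of M (\<Union>m. T (Suc k) (b(k := m)))"
      using P outer_measure_of_mono less_le_trans by blast
    \<comment> \<open>Continuity from below holds for the outer measure of arbitrary sets, and
      \<open>T\<close> is not known to be measurable. The strict inequality lets a single index
      \<open>m\<close> of the supremum preserve it.\<close>
    also have "\<dots> = (SUP m. outer_measure_of M (T (Suc k) (b(k := m))))"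
      by (rule SUP_outer_measure_of_incseq[OF Ts inc, symmetric])
    finally obtain m where "c < outer_measure_of M (T (Suc k) (b(k := m)))"
      unfolding less_SUP_iff by blast
    then show "\<exists>b'. c < outer_measure_of M (T (Suc k) b') \<and> (\<forall>j<k. b' j = b j)"
      by (intro exI[of _ "b(k := m)"]) simp
  qed
  then obtain f where f: "\<And>k. c < outer_measure_of M (T k (f k))" "\<And>k j. j < k \<Longrightarrow> f (Suc k) j = f k j"
    by blast
  define b where "b j = f (Suc j) j" for j
  have eq: "f k j = b j" if "j < k" for k j
    using that
  proof (induction k)
    case (Suc k)
    then show ?case using f(2)[of j k] by (cases "j = k") (auto simp: b_def)
  qed simp
  have cT: "c < outer_measure_of M (T k b)" for k
    using f(1)[of k] T_cong[of k "f k" b] eq by simp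
  \<comment> \<open>\<open>box k\<close> lists the admissible prefixes of length \<open>k\<close>,
    padded by \<open>0\<close>; there are finitely many. \<open>H k \<sigma>\<close> keeps those
    levels up to \<open>k\<close> that the prefix already decides and puts the whole space for the
    others, so \<open>B k\<close> is a finite union of measurable sets that still contains
    \<open>T k b\<close>.\<close>
  define box where "box k = {\<sigma>. (\<forall>j<k. \<sigma> j \<le> b j) \<and> (\<forall>j\<ge>k. \<sigma> j = 0)}" for k
  define det where "det k n \<sigma> \<longleftrightarrow> (\<forall>\<sigma>'. (\<forall>j<k. \<sigma>' j = \<sigma> j) \<longrightarrow> G n \<sigma>' = G n \<sigma>)" for k n \<sigma>
  define H where "H k \<sigma> = (\<Inter>n\<le>k. if det k n \<sigma> then G n \<sigma> else space M)" for k \<sigma>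
  define B where "B k = (\<Union>\<sigma>\<in>box k. H k \<sigma>)" for k
  define C where "C k = (\<Inter>i\<le>k. B i)" for k
  have fin_box: "finite (box k)" for k
  proof (rule finite_surj)
    show "finite (PiE {..<k} (\<lambda>j. {..b j}))" by (rule finite_PiE) auto
    show "box k \<subseteq> (\<lambda>g j. if j < k then g j else 0) ` PiE {..<k} (\<lambda>j. {..b j})"
    proof
      fix \<sigma> assume "\<sigma> \<in> box k"
      then show "\<sigma> \<in> (\<lambda>g j. if j < k then g j else 0) ` PiE {..<k} (\<lambda>j. {..b j})"
        by (intro image_eqI[of _ _ "restrict \<sigma> {..<k}"]) (auto simp: box_def fun_eq_iff)
    qed
  qed
  have H: "H k \<sigma> \<in> sets M" for k \<sigma>
    unfolding H_def by (rule sets.finite_INT) (auto simp: G)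
  have B: "B k \<in> sets M" for k
    unfolding B_def by (rule sets.finite_UN[OF fin_box]) (rule H)
  have C: "C k \<in> sets M" for k unfolding C_def by (rule sets.finite_INT) (auto simp: B)
  have TB: "T k b \<subseteq> B i" if "i \<le> k" for i k
  proof
    fix x assume "x \<in> T k b"
    then obtain \<sigma> where s: "\<And>j. j < k \<Longrightarrow> \<sigma> j \<le> b j" "\<And>n. x \<in> G n \<sigma>"
      by (auto simp: T_def)
    define \<sigma>' where "\<sigma>' j = (if j < i then \<sigma> j else 0)" for j
    have "\<sigma>' \<in> box i" using s(1) that by (simp add: \<sigma>'_def box_def)
    moreover have "x \<in> H i \<sigma>'"
    proof -
      have "x \<in> G n \<sigma>'" if "det i n \<sigma>'" for n
      proof -
        have "\<forall>j<i. \<sigma> j = \<sigma>' j" by (simp add: \<sigma>'_def)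
        then have "G n \<sigma> = G n \<sigma>'" using that unfolding det_def by blast
        then show ?thesis using s(2)[of n] by simp
      qed
      moreover have "x \<in> space M" using s(2)[of 0] Gs by blast
      ultimately show ?thesis by (auto simp: H_def)
    qed
    ultimately show "x \<in> B i" unfolding B_def by blast
  qed
  have cC: "c \<le> emeasure M (C k)" for k
  proof -
    have "T k b \<subseteq> C k" using TB by (auto simp: C_def)
    then have "outer_measure_of M (T k b) \<le> emeasure M (C k)"
      using outer_measure_of_mono[of "T k b" "C k" M] C by simp
    with cT show ?thesis by (meson less_imp_le less_le_trans)
  qed
  have "c \<le> emeasure M (\<Inter>k. C k)"
  proof -
    have "(INF k. emeasure M (C k)) = emeasure M (\<Inter>k. C k)"
    proof (rule INF_emeasure_decseq)
      show "range C \<subseteq> sets M" using C by auto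
      show "decseq C" by (auto simp: decseq_def C_def)
      show "emeasure M (C i) \<noteq> \<infinity>" for i
        using finite_measure.emeasure_finite[OF fin] by simp
    qed
    then show ?thesis using cC by (metis INF_greatest)
  qed
  moreover have "(\<Inter>k. C k) \<in> sets M" using C by auto
  moreover have "(\<Inter>k. C k) \<subseteq> (\<Union>\<sigma>. \<Inter>n::nat. G n \<sigma>)"
  proof
    fix x assume x: "x \<in> (\<Inter>k. C k)"
    have "x \<in> B k" for k using x by (auto simp: C_def)
    then have "\<forall>k. \<exists>\<sigma>. \<sigma> \<in> box k \<and> x \<in> H k \<sigma>" by (auto simp: B_def)
    then obtain s where s: "\<And>k. s k \<in> box k" "\<And>k. x \<in> H k (s k)" by metis
    obtain \<sigma> where \<sigma>: "\<And>k m. \<exists>m'\<ge>m. \<forall>j<k. s m' j = \<sigma> j"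
      using bounded_sequences_cluster[of s b] s(1) by (auto simp: box_def)
    have "x \<in> G n \<sigma>" for n
    proof -
      obtain N where "\<forall>\<sigma>'. (\<forall>k<N. \<sigma>' k = \<sigma> k) \<longrightarrow> G n \<sigma>' = G n \<sigma>"
        using finitely_determinedD[OF G(1), of \<sigma> n] ..
      then have N: "\<And>\<sigma>'. (\<And>k. k < N \<Longrightarrow> \<sigma>' k = \<sigma> k) \<Longrightarrow> G n \<sigma>' = G n \<sigma>" by blast
      \<comment> \<open>\<open>N \<le> m\<close> ensures that the prefix of \<open>s m\<close> of
        length \<open>m\<close> decides level \<open>n\<close>, and \<open>n \<le> m\<close> that
        level \<open>n\<close> occurs in \<open>H m\<close>.\<close>
      obtain m where m: "m \<ge> max N n" "\<And>j. j < N \<Longrightarrow> s m j = \<sigma> j" using \<sigma> by blast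
      have "det m n (s m)"
        unfolding det_def
      proof (intro allI impI)
        fix \<sigma>' assume "\<forall>j<m. \<sigma>' j = s m j"
        then have "G n \<sigma>' = G n \<sigma>" using m by (intro N) auto
        also have "\<dots> = G n (s m)" using N[of "s m"] m by simp
        finally show "G n \<sigma>' = G n (s m)" .
      qed
      then have "x \<in> G n (s m)" using s(2)[of m] m(1) by (auto simp: H_def split: if_splits)
      also have "G n (s m) = G n \<sigma>" using m by (intro N) auto
      finally show ?thesis .
    qed
    then show "x \<in> (\<Union>\<sigma>. \<Inter>n::nat. G n \<sigma>)" by blast
  qed
  ultimately show ?thesis by (intro bexI[of _ "\<Inter>k. C k"] conjI)
qed

text \<open>Inner approximation makes the supremum of the measures of measurable subsets equal to
  the outer measure, which a measurable hull \<open>E\<close> attains; a countable union of such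
  subsets attains the supremum. The set then lies between two measurable sets of equal finite
  measure, and completeness applies.\<close>

lemma (in complete_measure) souslin_sets_measurable:
  assumes fin: "finite_measure M" and T: "T \<in> souslin_sets (sets M)"
  shows "T \<in> sets M"
proof -
  interpret finite_measure M by fact
  obtain G where G: "\<And>n. finitely_determined (G n)" "\<And>n \<sigma>. G n \<sigma> \<in> sets M"
    and Teq: "T = (\<Union>\<sigma>. \<Inter>n::nat. G n \<sigma>)"
    using souslin_setsD[OF T] by blast
  have "T \<subseteq> (\<Union>\<sigma>. G 0 \<sigma>)" unfolding Teq by blast
  then have "T \<subseteq> space M" using sets.sets_into_space[OF G(2)] by blast
  from outer_measure_of_attain[OF this]
  obtain E where E: "E \<in> sets M" "T \<subseteq> E" "outer_measure_of M T = emeasure M E"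
    by (elim bexE conjE)
  define S where "S = (\<Squnion>B\<in>{B \<in> sets M. B \<subseteq> T}. emeasure M B)"
  have S: "S = emeasure M E"
  proof (rule antisym)
    show "S \<le> emeasure M E" unfolding S_def
      by (rule SUP_least) (use E in \<open>auto intro: emeasure_mono\<close>)
    show "emeasure M E \<le> S"
    proof (rule dense_le)
      fix c assume "c < emeasure M E"
      then have "c < outer_measure_of M (\<Union>\<sigma>. \<Inter>n. G n \<sigma>)"
        unfolding E(3)[symmetric] Teq .
      from souslin_inner_approximation[OF fin G this]
      obtain B where "B \<in> sets M" "B \<subseteq> T" "c \<le> emeasure M B"
        unfolding Teq by (elim bexE conjE)
      then show "c \<le> S" unfolding S_def by (intro SUP_upper2[of B]) simp_all
    qed
  qed
  have "{B \<in> sets M. B \<subseteq> T} \<noteq> {}" by auto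
  from ennreal_SUP_countable_SUP[OF this, of "emeasure M"] obtain e :: "nat \<Rightarrow> ennreal" where
    e: "range e \<subseteq> emeasure M ` {B \<in> sets M. B \<subseteq> T}" "S = (SUP i. e i)"
    by (auto simp: S_def)
  have "\<forall>i. \<exists>B. B \<in> sets M \<and> B \<subseteq> T \<and> e i = emeasure M B"
  proof
    fix i
    show "\<exists>B. B \<in> sets M \<and> B \<subseteq> T \<and> e i = emeasure M B" using range_subsetD[OF e(1), of i] by auto
  qed
  from choice[OF this] obtain B where
    B': "\<forall>i. B i \<in> sets M \<and> B i \<subseteq> T \<and> e i = emeasure M (B i)" by (elim exE)
  then have B: "\<And>i. B i \<in> sets M" "\<And>i. B i \<subseteq> T" "\<And>i. e i = emeasure M (B i)" by blast+
  have UB: "(\<Union>i. B i) \<in> sets M" "(\<Union>i. B i) \<subseteq> T" using B by auto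
  have "emeasure M E \<le> emeasure M (\<Union>i. B i)"
    unfolding S[symmetric] e(2) B(3) by (rule SUP_least) (use UB B in \<open>auto intro!: emeasure_mono\<close>)
  moreover have "emeasure M (\<Union>i. B i) \<le> emeasure M E"
    using UB E by (intro emeasure_mono) auto
  ultimately show ?thesis
    by (intro complete_sets_sandwich[OF UB(1) E(1) UB(2) E(2)]) (simp_all add: antisym less_top[symmetric])
qed

section \<open>Projection along a Euclidean factor\<close>

text \<open>Projection does not commute with intersections in general, but it does when the sections
  are compact and decreasing, by the finite intersection property. Hence each level is first
  replaced by a finite intersection of levels, which is again a rectangle with a compact
  side.\<close>

lemma souslin_sets_projection:
  fixes A :: "('a \<times> 'b::t2_space) set"
  assumes A: "A \<in> souslin_sets {F \<times> K | F K. F \<in> sets M \<and> compact K}"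
  shows "fst ` A \<in> souslin_sets (sets M)"
proof -
  obtain G where G: "\<And>n. finitely_determined (G n)"
    "\<And>n \<sigma>. G n \<sigma> \<in> {F \<times> K | F K. F \<in> sets M \<and> compact K}" "A = (\<Union>\<sigma>. \<Inter>n::nat. G n \<sigma>)"
    using souslin_setsD[OF A] by blast
  have fdI: "finitely_determined (\<lambda>\<sigma>. \<Inter>j\<le>n. G j \<sigma>)" for n
    by (rule finitely_determined_INT) (rule G)
  have FK: "\<exists>F K. F \<in> sets M \<and> compact K \<and> (\<Inter>j\<le>n. G j \<sigma>) = F \<times> K" for n \<sigma>
  proof (induction n)
    case 0 then show ?case using G(2)[of 0 \<sigma>] by auto
  next
    case (Suc n)
    then obtain F K where FK: "F \<in> sets M" "compact K" "(\<Inter>j\<le>n. G j \<sigma>) = F \<times> K" by blast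
    obtain F' K' where "F' \<in> sets M" "compact K'" "G (Suc n) \<sigma> = F' \<times> K'" using G(2)[of "Suc n" \<sigma>] by blast
    then show ?case using FK
      by (intro exI[of _ "F' \<inter> F"] exI[of _ "K' \<inter> K"]) (auto simp: atMost_Suc compact_Int)
  qed
  show ?thesis
  proof (rule souslin_setsI)
    show "finitely_determined (\<lambda>\<sigma>. fst ` (\<Inter>j\<le>n. G j \<sigma>))" for n
      by (rule finitely_determined_map2[OF fdI[of n] fdI[of n], where g = "\<lambda>a b. fst ` a"])
    show "fst ` (\<Inter>j\<le>n. G j \<sigma>) \<in> sets M" for n \<sigma>
    proof -
      \<comment> \<open>The projection of the rectangle is \<open>F\<close>, or empty if
        \<open>K\<close> is empty.\<close>
      obtain F K where "F \<in> sets M" "(\<Inter>j\<le>n. G j \<sigma>) = F \<times> K" using FK by metis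
      then show ?thesis by (cases "K = {}") auto
    qed
    show "fst ` A = (\<Union>\<sigma>. \<Inter>n. fst ` (\<Inter>j\<le>n. G j \<sigma>))"
    proof (intro equalityI subsetI)
      fix x assume "x \<in> fst ` A"
      then obtain y \<sigma> where "\<And>n. (x, y) \<in> G n \<sigma>" unfolding G(3) by force
      then have "(x, y) \<in> (\<Inter>j\<le>n. G j \<sigma>)" for n by blast
      then have "x \<in> fst ` (\<Inter>j\<le>n. G j \<sigma>)" for n by (metis fst_conv image_eqI)
      then show "x \<in> (\<Union>\<sigma>. \<Inter>n. fst ` (\<Inter>j\<le>n. G j \<sigma>))" by blast
    next
      fix x assume "x \<in> (\<Union>\<sigma>. \<Inter>n. fst ` (\<Inter>j\<le>n. G j \<sigma>))"
      then obtain \<sigma> where s: "\<And>n. x \<in> fst ` (\<Inter>j\<le>n. G j \<sigma>)" by blast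
      define K where "K n = {y. (x, y) \<in> (\<Inter>j\<le>n. G j \<sigma>)}" for n
      have K: "compact (K n)" "K n \<noteq> {}" for n
      proof -
        show "K n \<noteq> {}" using s[of n] by (force simp: K_def)
        obtain F K' where FK': "compact K'" "(\<Inter>j\<le>n. G j \<sigma>) = F \<times> K'" using FK by metis
        have "x \<in> F" using s[of n] unfolding FK'(2) by (auto split: if_splits)
        then have "K n = K'" by (simp add: K_def FK'(2))
        then show "compact (K n)" using FK' by simp
      qed
      have mono: "K n \<subseteq> K m" if "m \<le> n" for m n using that by (auto simp: K_def)
      have "K 0 \<inter> (\<Inter>n\<in>UNIV. K n) \<noteq> {}"
      proof (rule compact_imp_fip_image)
        show "compact (K 0)" by (rule K)
        show "closed (K n)" for n using K compact_imp_closed by blast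
        fix I' :: "nat set" assume I: "finite I'"
        have "K (Max (insert 0 I')) \<subseteq> K i" if "i \<in> insert 0 I'" for i
          using I that by (intro mono Max_ge) auto
        then have "K (Max (insert 0 I')) \<subseteq> K 0 \<inter> \<Inter> (K ` I')" by blast
        then show "K 0 \<inter> \<Inter> (K ` I') \<noteq> {}" using K(2) by blast
      qed
      then obtain y where "\<And>n. y \<in> K n" by blast
      then have "(x, y) \<in> A" unfolding G(3) K_def by blast
      then show "x \<in> fst ` A" by force
    qed
  qed
qed

lemma souslin_sets_Int:
  assumes "A \<in> souslin_sets \<P>" "B \<in> souslin_sets \<P>"
  shows "A \<inter> B \<in> souslin_sets \<P>"
  unfolding Int_range_binary by (rule souslin_sets_INT) (simp add: binary_def assms)

lemma souslin_sets_Un: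
  assumes "A \<in> souslin_sets \<P>" "B \<in> souslin_sets \<P>"
  shows "A \<union> B \<in> souslin_sets \<P>"
  unfolding Un_range_binary by (rule souslin_sets_UN) (simp add: binary_def assms)

lemma open_countable_Union_compact:
  fixes U :: "'b::euclidean_space set"
  assumes "open U"
  shows "\<exists>K. (\<forall>n::nat. compact (K n)) \<and> U = (\<Union>n. K n)"
proof -
  obtain D where D: "countable D" "D \<subseteq> Pow U" "\<And>X. X \<in> D \<Longrightarrow> \<exists>a b. X = cbox a b" "\<Union>D = U"
    using open_countable_Union_open_cbox[OF assms] by metis
  \<comment> \<open>The empty set is added because \<open>D\<close> may be empty, while an
    enumeration by all of \<open>nat\<close> needs a nonempty family.\<close>
  define K where "K = from_nat_into (insert {} D)"
  have r: "range K = insert {} D" unfolding K_def using D(1) by (intro range_from_nat_into) auto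
  have "compact (K n)" for n
  proof -
    have "K n \<in> insert {} D" using r by blast
    then show ?thesis using D(3)[of "K n"] by auto
  qed
  moreover have "U = (\<Union>n. K n)" unfolding r using D(4) by simp
  ultimately show ?thesis by blast
qed

text \<open>Souslin sets are in general not closed under complements, so the induction over the
  generated sigma-field runs on \<open>Q\<close>, which asks that the set and its complement are
  both Souslin. At the generators this requires open and closed second factors alike; in a Euclidean
  space both are countable unions of compact sets.\<close>

lemma sets_pair_borel_souslin:
  fixes A :: "('a \<times> 'b::euclidean_space) set"
  assumes "A \<in> sets (M \<Otimes>\<^sub>M borel)"
  shows "A \<in> souslin_sets {F \<times> K | F K. F \<in> sets M \<and> compact K}"
proof -
  define S where "S = souslin_sets {F \<times> K | F (K :: 'b set). F \<in> sets M \<and> compact K}"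
  define Q where "Q A \<longleftrightarrow> A \<in> S \<and> space M \<times> UNIV - A \<in> S" for A
  have SUN: "(\<Union>n::nat. F \<times> K n) \<in> S" if "F \<in> sets M" "\<And>n. compact (K n)" for F K
    unfolding S_def using that by (intro souslin_sets_UN souslin_sets_basic) blast
  have S_open: "F \<times> U \<in> S" if F: "F \<in> sets M" and U: "open U" for F U
  proof -
    obtain K where K: "\<And>n::nat. compact (K n)" "U = (\<Union>n. K n)"
      using open_countable_Union_compact[OF U] by blast
    have "F \<times> U = (\<Union>n. F \<times> K n)" by (auto simp: K(2))
    then show ?thesis using SUN[OF F K(1)] by simp
  qed
  have S_closed: "F \<times> C \<in> S" if F: "F \<in> sets M" and C: "closed C" for F C
  proof -
    have K: "compact (C \<inter> cball 0 (real n))" for n using C by (simp add: closed_Int_compact)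
    have "F \<times> C = (\<Union>n. F \<times> (C \<inter> cball 0 (real n)))" by (auto simp: real_arch_simple)
    then show ?thesis using SUN[OF F K] by simp
  qed
  have Q_UN: "Q (\<Union>i. A i)" if "\<And>i::nat. Q (A i)" for A
  proof -
    have "space M \<times> UNIV - (\<Union>i. A i) = (\<Inter>i. space M \<times> UNIV - A i)" by blast
    then show ?thesis using that unfolding Q_def S_def
      by (simp only:) (intro conjI souslin_sets_INT souslin_sets_UN; simp)
  qed
  have Q_Int: "Q (A \<inter> B)" if "Q A" "Q B" for A B
  proof -
    have "space M \<times> UNIV - (A \<inter> B) = (space M \<times> UNIV - A) \<union> (space M \<times> UNIV - B)" by blast
    then show ?thesis using that by (simp add: Q_def S_def souslin_sets_Int souslin_sets_Un)
  qed
  have Q_compl: "Q (space M \<times> UNIV - A)" if "Q A" "A \<subseteq> space M \<times> UNIV" for A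
    using that by (simp add: Q_def double_diff)
  have Q_empty: "Q {}" using S_open[of "space M" UNIV] S_open[of "{}" UNIV] by (simp add: Q_def)
  have Q_snd: "Q (space M \<times> B)" if "B \<in> sets borel" for B :: "'b set"
    using that unfolding borel_def sets_measure_of[OF subset_UNIV[of "{S. open S}", folded Pow_UNIV]]
  proof (induction rule: sigma_sets.induct)
    case (Basic U)
    moreover have "space M \<times> UNIV - space M \<times> U = space M \<times> - U" by blast
    moreover from Basic have "closed (- U)" by (simp add: closed_Compl)
    ultimately show ?case using S_open[of "space M" U] S_closed[of "space M" "- U"]
      by (simp add: Q_def)
  next
    case (Compl B)
    have "space M \<times> (UNIV - B) = space M \<times> UNIV - space M \<times> B" by blast
    then show ?case using Q_compl[OF Compl.IH] by auto
  next
    case (Union B)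
    have "space M \<times> (\<Union>i. B i) = (\<Union>i. space M \<times> B i)" by blast
    then show ?case using Q_UN[of "\<lambda>i. space M \<times> B i"] Union.IH by simp
  qed (simp add: Q_empty)
  have Q_fst: "Q (F \<times> UNIV)" if "F \<in> sets M" for F
  proof -
    have "space M \<times> UNIV - F \<times> UNIV = (space M - F) \<times> (UNIV :: 'b set)" by blast
    then show ?thesis using that S_open[of F UNIV] S_open[of "space M - F" UNIV] by (simp add: Q_def)
  qed
  have "A \<subseteq> space M \<times> UNIV \<and> Q A"
    using assms unfolding sets_pair_measure space_borel
  proof (induction rule: sigma_sets.induct)
    case (Basic A)
    then obtain F B where FB: "A = F \<times> B" "F \<in> sets M" "B \<in> sets borel" by blast
    then have "A = (F \<times> UNIV) \<inter> (space M \<times> B)" using sets.sets_into_space by auto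
    then show ?case using Q_Int[OF Q_fst Q_snd] FB by auto
  next
    case (Compl A)
    then show ?case using Q_compl[of A] by blast
  next
    case (Union A)
    then show ?case using Q_UN[of A] by blast
  qed (simp add: Q_empty)
  then show ?thesis by (simp add: Q_def S_def)
qed

text \<open>The points \<open>x\<close> for which some \<open>y\<close> exists form the image under
  \<open>fst\<close> of a set in the product sigma-field. Since \<open>'b\<close> may be any
  Euclidean space, several reals can be quantified at once by packing them into a tuple.\<close>

theorem (in complete_measure) measurable_projection:
  fixes \<Phi> :: "'a \<Rightarrow> 'b::euclidean_space \<Rightarrow> bool"
  assumes "finite_measure M" and "Measurable.pred (M \<Otimes>\<^sub>M borel) (\<lambda>(x, y). \<Phi> x y)"
  shows "Measurable.pred M (\<lambda>x. \<exists>y. \<Phi> x y)"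
proof -
  let ?A = "{z \<in> space (M \<Otimes>\<^sub>M borel). case z of (x, y) \<Rightarrow> \<Phi> x y}"
  have "?A \<in> sets (M \<Otimes>\<^sub>M borel)" using assms(2) by (simp add: pred_def)
  then have "fst ` ?A \<in> sets M"
    by (intro souslin_sets_measurable[OF assms(1)] souslin_sets_projection sets_pair_borel_souslin)
  also have "fst ` ?A = {x \<in> space M. \<exists>y. \<Phi> x y}" by (force simp: space_pair_measure)
  finally show ?thesis by (simp add: pred_def)
qed

corollary (in complete_measure) measurable_projection_all:
  fixes \<Phi> :: "'a \<Rightarrow> 'b::euclidean_space \<Rightarrow> bool"
  assumes "finite_measure M" and [measurable]: "Measurable.pred (M \<Otimes>\<^sub>M borel) (\<lambda>(x, y). \<Phi> x y)"
  shows "Measurable.pred M (\<lambda>x. \<forall>y. \<Phi> x y)"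
proof -
  have "Measurable.pred M (\<lambda>x. \<exists>y. \<not> \<Phi> x y)"
    by (rule measurable_projection[OF assms(1)]) (simp add: split_beta' measurable)
  then show ?thesis by (auto dest: pred_intros_logic(2))
qed


section \<open>Measurability of the path\<close>

lemma skorohod_space_M1: "\<rho> \<in> skorohod_space \<Longrightarrow> 0 \<le> t \<Longrightarrow> \<rho> t \<in> M1"
  by (auto simp: skorohod_space_def PiE_iff)

lemma M1_iff: "\<mu> \<in> M1 \<longleftrightarrow> prob_space \<mu> \<and> sets \<mu> = sets unit_borel"
  by (auto simp: M1_def space_prob_algebra)

lemma M1_space: "\<mu> \<in> M1 \<Longrightarrow> space \<mu> = {0..1}"
  using sets_eq_imp_space_eq[of \<mu> unit_borel]
  by (simp add: M1_iff unit_borel_def space_restrict_space)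

lemma sets_unit_borel_iff: "A \<in> sets unit_borel \<longleftrightarrow> A \<in> sets borel \<and> A \<subseteq> {0..1}"
  unfolding unit_borel_def by (subst sets_restrict_space_iff) auto

lemma measurable_unit_borel_borel: "f \<in> borel_measurable borel \<Longrightarrow> f \<in> borel_measurable unit_borel"
  unfolding unit_borel_def by (rule measurable_restrict_space1)

lemma continuous_on_borel_measurable_M1:
  assumes "\<mu> \<in> M1" and f: "continuous_on {0..1} (f :: real \<Rightarrow> real)"
  shows "f \<in> borel_measurable \<mu>"
proof -
  have "f \<in> borel_measurable unit_borel"
    unfolding unit_borel_def by (rule borel_measurable_continuous_on_restrict[OF f])
  then show ?thesis using assms(1) measurable_cong_sets[of \<mu> unit_borel borel borel]
    by (auto simp: M1_iff)
qed

lemma skorohod_right_continuous: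
  fixes f :: "real \<Rightarrow> real"
  assumes \<rho>: "\<rho> \<in> skorohod_space" and f: "continuous_on {0..1} f" and t: "0 \<le> t"
  shows "((\<lambda>s. \<integral>x. f x \<partial>(\<rho> s)) \<longlongrightarrow> (\<integral>x. f x \<partial>(\<rho> t))) (at_right t)"
proof (rule topological_tendstoI)
  fix S :: "real set" assume S: "open S" "(\<integral>x. f x \<partial>(\<rho> t)) \<in> S"
  let ?U = "{\<mu> \<in> M1. (\<integral>x. f x \<partial>\<mu>) \<in> S}"
  have U: "openin weak_topology ?U"
    unfolding weak_topology_def by (rule topology_generated_by_Basis) (use f S in blast)
  have "{0..} \<inter> {t<..} = {t<..}" using t by auto
  then have "limitin weak_topology \<rho> (\<rho> t) (at_right t)"
    using \<rho> t unfolding skorohod_space_def cadlag_on_def by (metis (no_types, lifting) atLeast_iff mem_Collect_eq)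
  then have "eventually (\<lambda>s. \<rho> s \<in> ?U) (at_right t)"
    using U S skorohod_space_M1[OF \<rho> t] unfolding limitin_def by blast
  then show "eventually (\<lambda>s. (\<integral>x. f x \<partial>(\<rho> s)) \<in> S) (at_right t)"
    by (rule eventually_mono) simp
qed

text \<open>A small time change can move a jump across a fixed time, but an open interval of times
  absorbs it: a witness \<open>s\<close> for the limit path yields the witnesses
  \<open>\<tau> n s\<close> for the approximating paths, and these tend to \<open>s\<close>.\<close>

lemma skorohod_open_excursion:
  fixes f :: "real \<Rightarrow> real"
  assumes f: "continuous_on {0..1} f"
  shows "skorohod_open {\<rho> \<in> skorohod_space. \<exists>s\<in>{a<..<b}. 0 \<le> s \<and> c < (\<integral>x. f x \<partial>(\<rho> s))}"
    (is "skorohod_open ?U")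
  unfolding skorohod_open_def
proof (intro conjI ballI allI impI)
  fix \<rho> r assume "\<rho> \<in> ?U" and r: "(\<forall>n. r n \<in> skorohod_space) \<and> skorohod_conv r \<rho>"
  then obtain s where s: "a < s" "s < b" "0 \<le> s" "c < (\<integral>x. f x \<partial>(\<rho> s))" by auto
  obtain \<tau> where \<tau>: "\<And>n. \<tau> n \<in> time_changes" "uniform_limit {0..} \<tau> (\<lambda>s. s) sequentially"
    "uniform_limit {0..s} (\<lambda>n s. \<integral>x. f x \<partial>(r n (\<tau> n s))) (\<lambda>s. \<integral>x. f x \<partial>(\<rho> s)) sequentially"
    using r f unfolding skorohod_conv_def by blast
  have "(\<lambda>n. \<tau> n s) \<longlonglongrightarrow> s" using tendsto_uniform_limitI[OF \<tau>(2)] s by simp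
  then have "eventually (\<lambda>n. a < \<tau> n s) sequentially" "eventually (\<lambda>n. \<tau> n s < b) sequentially"
    using s by (auto intro: order_tendstoD)
  moreover have "(\<lambda>n. \<integral>x. f x \<partial>(r n (\<tau> n s))) \<longlonglongrightarrow> (\<integral>x. f x \<partial>(\<rho> s))"
    using tendsto_uniform_limitI[OF \<tau>(3), of s] s by simp
  then have "eventually (\<lambda>n. c < (\<integral>x. f x \<partial>(r n (\<tau> n s)))) sequentially"
    using s by (auto intro: order_tendstoD)
  ultimately show "eventually (\<lambda>n. r n \<in> ?U) sequentially"
  proof eventually_elim
    case (elim n)
    have "0 \<le> \<tau> n s"
      using \<tau>(1)[of n] s(3) by (auto simp: time_changes_def bij_betw_def)
    then show ?case using elim r by auto
  qed
qed auto

text \<open>The masses of half-lines are limits of integrals of continuous functions. Half-lines,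
  traced on the unit interval, form an intersection-stable generator, so measurability of their
  masses is enough for a probability kernel.\<close>

lemma measurable_prob_algebra_unit_borel:
  assumes M1: "\<And>z. z \<in> space N \<Longrightarrow> K z \<in> M1"
    and meas: "\<And>f :: real \<Rightarrow> real. continuous_on UNIV f \<Longrightarrow> (\<lambda>z. \<integral>x. f x \<partial>(K z)) \<in> borel_measurable N"
  shows "K \<in> N \<rightarrow>\<^sub>M prob_algebra unit_borel"
proof (rule measurable_prob_algebra_generated)
  show "sets unit_borel = sigma_sets {0..1} ((\<inter>) {0..1} ` range atMost)"
  proof -
    have "sets unit_borel = (\<inter>) {0..1} ` sigma_sets UNIV (range (atMost :: real \<Rightarrow> real set))"
      unfolding unit_borel_def sets_restrict_space borel_eq_atMost by simp
    also have "\<dots> = sigma_sets {0..1} ((\<inter>) {0..1} ` range atMost)"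
    proof (rule sigma_sets_Int)
      have "({0..1} :: real set) \<in> sets (sigma UNIV (range atMost))"
        unfolding borel_eq_atMost[symmetric] by simp
      then show "({0..1} :: real set) \<in> sigma_sets UNIV (range atMost)" by simp
    qed simp
    finally show ?thesis .
  qed
  show "Int_stable ((\<inter>) {0..1} ` range (atMost :: real \<Rightarrow> real set))"
  proof (rule Int_stableI_image)
    fix A B :: "real set" assume "A \<in> range atMost" "B \<in> range atMost"
    then obtain a b where "A = {..a}" "B = {..b}" by auto
    then have "({0..1} \<inter> A) \<inter> ({0..1} \<inter> B) = {0..1} \<inter> {..min a b}" by auto
    then show "\<exists>C\<in>range atMost. ({0..1} \<inter> A) \<inter> ({0..1} \<inter> B) = {0..1} \<inter> C" by blast
  qed
  show "(\<inter>) {0..1} ` range atMost \<subseteq> Pow {0..1 :: real}" by auto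
  show "prob_space (K a)" "sets (K a) = sets unit_borel" if "a \<in> space N" for a
    using M1[OF that] by (auto simp: M1_iff)
  fix A :: "real set" assume "A \<in> (\<inter>) {0..1} ` range atMost"
  then obtain a where A: "A = {0..1} \<inter> {..a}" by blast
  \<comment> \<open>For \<open>n > 0\<close> a linear cut-off, equal to \<open>1\<close> up to
    \<open>a\<close> and to \<open>0\<close> from \<open>a + 1 / n\<close> on; it decreases to the
    indicator of \<open>{..a}\<close>.\<close>
  define h where "h n y = max 0 (min 1 (1 - real n * (y - a)))" for n y
  have "(\<lambda>n. \<integral>x. h n x \<partial>(K z)) \<longlonglongrightarrow> measure (K z) A" if z: "z \<in> space N" for z
  proof -
    interpret prob_space "K z" using M1[OF z] by (simp add: M1_iff)
    have AS: "A \<in> sets (K z)" using M1[OF z] by (simp add: M1_iff A sets_unit_borel_iff)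
    have "(\<lambda>n. \<integral>x. h n x \<partial>(K z)) \<longlonglongrightarrow> (\<integral>x. indicator A x \<partial>(K z))"
    proof (rule integral_dominated_convergence[where w = "\<lambda>_. 1"])
      show "indicator A \<in> borel_measurable (K z)" using AS by simp
      show "h n \<in> borel_measurable (K z)" for n
        by (rule continuous_on_borel_measurable_M1[OF M1[OF z]]) (auto simp: h_def intro!: continuous_intros)
      show "AE x in K z. norm (h n x) \<le> 1" for n by (auto simp: h_def)
      show "AE x in K z. (\<lambda>n. h n x) \<longlonglongrightarrow> indicator A x"
      proof (rule AE_I2)
        fix x assume "x \<in> space (K z)"
        then have x: "x \<in> {0..1}" using M1_space[OF M1[OF z]] by simp
        show "(\<lambda>n. h n x) \<longlonglongrightarrow> indicator A x"
        proof (cases "x \<le> a")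
          case True
          then have "h n x = 1" for n by (simp add: h_def mult_nonneg_nonpos)
          then show ?thesis using True x by (simp add: A)
        next
          case False
          \<comment> \<open>From this index on, \<open>x\<close> lies beyond
            \<open>a + 1 / n\<close>, where the cut-off vanishes.\<close>
          obtain n0 :: nat where n0: "1 / (x - a) < real n0" using reals_Archimedean2 by blast
          have "h n x = 0" if "n \<ge> n0" for n
          proof -
            have "1 / (x - a) < real n" using n0 that by simp
            then have "1 < real n * (x - a)" using False by (simp add: field_simps)
            then show ?thesis by (simp add: h_def)
          qed
          then have "(\<lambda>n. h n x) \<longlonglongrightarrow> 0"
            by (intro tendsto_eventually eventually_sequentiallyI[of n0])
          then show ?thesis using False by (simp add: A)
        qed
      qed
    qed simp
    then show ?thesis using AS by simp
  qed
  moreover have "(\<lambda>z. \<integral>x. h n x \<partial>(K z)) \<in> borel_measurable N" for n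
    by (rule meas) (auto simp: h_def intro!: continuous_intros)
  ultimately have "(\<lambda>z. measure (K z) A) \<in> borel_measurable N"
    by (rule borel_measurable_LIMSEQ_real)
  then have "(\<lambda>z. ennreal (measure (K z) A)) \<in> borel_measurable N" by simp
  also have "(\<lambda>z. ennreal (measure (K z) A)) \<in> borel_measurable N \<longleftrightarrow>
      (\<lambda>z. emeasure (K z) A) \<in> borel_measurable N"
  proof (rule measurable_cong)
    fix z assume "z \<in> space N"
    then interpret prob_space "K z" using M1 by (simp add: M1_iff)
    show "ennreal (measure (K z) A) = emeasure (K z) A" by (simp add: emeasure_eq_measure)
  qed
  finally show "(\<lambda>z. emeasure (K z) A) \<in> borel_measurable N" .
qed

text \<open>The set may vary with the parameter: the lemma serves for the singleton of a variable
  position and for the complement of the finite set of Eves found so far. The intersection with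
  \<open>{0..1}\<close> keeps the set inside the space of the measures.\<close>

lemma measurable_measure_section:
  fixes A :: "'z \<Rightarrow> real set"
  assumes K: "K \<in> N \<rightarrow>\<^sub>M prob_algebra unit_borel"
    and A: "Measurable.pred (N \<Otimes>\<^sub>M borel) (\<lambda>(z, x). x \<in> A z)"
  shows "(\<lambda>z. measure (K z) ({0..1} \<inter> A z)) \<in> borel_measurable N"
proof (rule measure_measurable_prob_algebra2[OF _ K])
  have "(\<lambda>p. (fst p, snd p)) \<in> N \<Otimes>\<^sub>M unit_borel \<rightarrow>\<^sub>M N \<Otimes>\<^sub>M borel"
    by (intro measurable_Pair measurable_fst measurable_compose[OF measurable_snd]
        measurable_unit_borel_borel measurable_ident_sets refl)
  then have "Measurable.pred (N \<Otimes>\<^sub>M unit_borel) (\<lambda>p. case p of (z, x) \<Rightarrow> x \<in> A z)"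
    using measurable_compose[OF _ A, of "\<lambda>p. p" "N \<Otimes>\<^sub>M unit_borel"] by simp
  then have "{p \<in> space (N \<Otimes>\<^sub>M unit_borel). case p of (z, x) \<Rightarrow> x \<in> A z} \<in> sets (N \<Otimes>\<^sub>M unit_borel)"
    by (simp add: pred_def)
  also have "{p \<in> space (N \<Otimes>\<^sub>M unit_borel). case p of (z, x) \<Rightarrow> x \<in> A z}
      = Sigma (space N) (\<lambda>z. {0..1} \<inter> A z)"
    by (auto simp: space_pair_measure unit_borel_def space_restrict_space)
  finally show "Sigma (space N) (\<lambda>z. {0..1} \<inter> A z) \<in> sets (N \<Otimes>\<^sub>M unit_borel)" .
qed

text \<open>Stands for the completed law of the process. Completeness and finiteness are what the
  projection theorem requires; the two assumptions tie the sigma-field to the Skorohod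
  topology.\<close>

locale skorohod_measure = complete_measure Q + finite_measure Q
  for Q :: "(real \<Rightarrow> real measure) measure" +
  assumes space_Q: "space Q = skorohod_space"
    and skorohod_open_sets: "skorohod_open U \<Longrightarrow> U \<in> sets Q"
begin

lemma measurable_integral_at:
  fixes f :: "real \<Rightarrow> real"
  assumes f: "continuous_on {0..1} f" and t: "0 \<le> t"
  shows "(\<lambda>\<rho>. \<integral>x. f x \<partial>(\<rho> t)) \<in> borel_measurable Q"
  unfolding borel_measurable_iff_greater
proof
  fix c :: real
  \<comment> \<open>The value at \<open>t\<close> exceeds \<open>c\<close> exactly if, for some
    margin \<open>1 / (k + 1)\<close>, excursions above \<open>c\<close> plus the margin occur in
    every right neighbourhood \<open>(t, t + 1 / (n + 1))\<close>. In the limit from the right the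
    margin survives as a weak inequality, which leaves a strict one for \<open>c\<close>.\<close>
  define U where "U k n = {\<rho> \<in> skorohod_space. \<exists>s\<in>{t<..<t + 1 / real (Suc n)}. 0 \<le> s \<and>
      c + 1 / real (Suc k) < (\<integral>x. f x \<partial>(\<rho> s))}" for k n
  have U: "U k n \<in> sets Q" for k n
    unfolding U_def by (rule skorohod_open_sets[OF skorohod_open_excursion[OF f]])
  have "{\<rho> \<in> space Q. c < (\<integral>x. f x \<partial>(\<rho> t))} = (\<Union>k. \<Inter>n. U k n)"
  proof (intro equalityI subsetI)
    fix \<rho> assume "\<rho> \<in> {\<rho> \<in> space Q. c < (\<integral>x. f x \<partial>(\<rho> t))}"
    then have \<rho>: "\<rho> \<in> skorohod_space" and "c < (\<integral>x. f x \<partial>(\<rho> t))" by (auto simp: space_Q)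
    then obtain k where "inverse (real (Suc k)) < (\<integral>x. f x \<partial>(\<rho> t)) - c"
      using reals_Archimedean[of "(\<integral>x. f x \<partial>(\<rho> t)) - c"] by auto
    then have "c + 1 / real (Suc k) < (\<integral>x. f x \<partial>(\<rho> t))" by (simp add: field_simps)
    from order_tendstoD(1)[OF skorohod_right_continuous[OF \<rho> f t] this]
    obtain b where b: "t < b" "\<And>s. t < s \<Longrightarrow> s < b \<Longrightarrow> c + 1 / real (Suc k) < (\<integral>x. f x \<partial>(\<rho> s))"
      unfolding eventually_at_right_field by blast
    have "\<rho> \<in> U k n" for n
    proof -
      obtain s where s: "t < s" "s < min b (t + 1 / real (Suc n))"
        using dense[of t "min b (t + 1 / real (Suc n))"] b(1) by auto
      then show ?thesis unfolding U_def using \<rho> b(2)[of s] t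
        by (intro CollectI conjI bexI[of _ s]) auto
    qed
    then show "\<rho> \<in> (\<Union>k. \<Inter>n. U k n)" by blast
  next
    fix \<rho> assume "\<rho> \<in> (\<Union>k. \<Inter>n. U k n)"
    then obtain k where k: "\<And>n. \<rho> \<in> U k n" by blast
    then have \<rho>: "\<rho> \<in> skorohod_space" by (auto simp: U_def)
    have "c + 1 / real (Suc k) \<le> (\<integral>x. f x \<partial>(\<rho> t))"
    proof (rule ccontr)
      assume "\<not> c + 1 / real (Suc k) \<le> (\<integral>x. f x \<partial>(\<rho> t))"
      then have "(\<integral>x. f x \<partial>(\<rho> t)) < c + 1 / real (Suc k)" by simp
      from order_tendstoD(2)[OF skorohod_right_continuous[OF \<rho> f t] this]
      obtain b where b: "t < b" "\<And>s. t < s \<Longrightarrow> s < b \<Longrightarrow> (\<integral>x. f x \<partial>(\<rho> s)) < c + 1 / real (Suc k)"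
        unfolding eventually_at_right_field by blast
      obtain n where n: "inverse (real (Suc n)) < b - t" using reals_Archimedean[of "b - t"] b(1) by auto
      obtain s where "t < s" "s < t + 1 / real (Suc n)" "c + 1 / real (Suc k) < (\<integral>x. f x \<partial>(\<rho> s))"
        using k[of n] unfolding U_def by auto
      moreover from this n have "s < b" by (simp add: inverse_eq_divide)
      ultimately show False using b(2)[of s] by simp
    qed
    moreover have "0 < 1 / real (Suc k)" by simp
    ultimately have "c < (\<integral>x. f x \<partial>(\<rho> t))" by linarith
    then show "\<rho> \<in> {\<rho> \<in> space Q. c < (\<integral>x. f x \<partial>(\<rho> t))}" using \<rho> by (simp add: space_Q)
  qed
  moreover have "(\<Union>k. \<Inter>n. U k n) \<in> sets Q" using U by blast
  ultimately show "{\<rho> \<in> space Q. c < (\<integral>x. f x \<partial>(\<rho> t))} \<in> sets Q" by simp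
qed

text \<open>Time is replaced by the next grid point \<open>\<theta> k (j k z)\<close>, strictly to
  the right and within \<open>1 / (k + 1)\<close>. For each \<open>k\<close> only countably many
  fixed times occur, and there \<open>measurable_integral_at\<close> applies; right-continuity gives
  the limit. The \<open>max 0\<close> extends the path to all real times.\<close>

lemma measurable_path_joint:
  "(\<lambda>(\<rho>, t). \<rho> (max 0 t)) \<in> Q \<Otimes>\<^sub>M borel \<rightarrow>\<^sub>M prob_algebra unit_borel"
proof (rule measurable_prob_algebra_unit_borel)
  show "(case z of (\<rho>, t) \<Rightarrow> \<rho> (max 0 t)) \<in> M1" if "z \<in> space (Q \<Otimes>\<^sub>M borel)" for z
    using that skorohod_space_M1 by (auto simp: space_pair_measure space_Q)
  fix f :: "real \<Rightarrow> real" assume f: "continuous_on UNIV f"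
  then have f01: "continuous_on {0..1} f" by (rule continuous_on_subset) simp
  define j where "j k z = nat \<lfloor>real (Suc k) * max 0 (snd z)\<rfloor>" for k and z :: "(real \<Rightarrow> real measure) \<times> real"
  define \<theta> where "\<theta> k i = real (Suc i) / real (Suc k)" for k i
  show "(\<lambda>z. \<integral>x. f x \<partial>(case z of (\<rho>, t) \<Rightarrow> \<rho> (max 0 t))) \<in> borel_measurable (Q \<Otimes>\<^sub>M borel)"
  proof (rule borel_measurable_LIMSEQ_real)
    have [measurable]: "j k \<in> Q \<Otimes>\<^sub>M borel \<rightarrow>\<^sub>M count_space UNIV" for k
      unfolding j_def by measurable
    show "(\<lambda>z. \<integral>x. f x \<partial>(fst z (\<theta> k (j k z)))) \<in> borel_measurable (Q \<Otimes>\<^sub>M borel)" for k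
    proof (rule measurable_compose_countable[where g = "j k" and f = "\<lambda>i z. \<integral>x. f x \<partial>(fst z (\<theta> k i))"])
      show "(\<lambda>z. \<integral>x. f x \<partial>(fst z (\<theta> k i))) \<in> borel_measurable (Q \<Otimes>\<^sub>M borel)" for i
        by (rule measurable_compose[OF measurable_fst measurable_integral_at[OF f01]]) (simp add: \<theta>_def)
    qed simp
    fix z :: "(real \<Rightarrow> real measure) \<times> real" assume "z \<in> space (Q \<Otimes>\<^sub>M borel)"
    then obtain \<rho> t where z: "z = (\<rho>, t)" and \<rho>: "\<rho> \<in> skorohod_space"
      by (cases z) (auto simp: space_pair_measure space_Q)
    have le: "max 0 t < \<theta> k (j k z)" "\<theta> k (j k z) \<le> max 0 t + 1 / real (Suc k)" for k
    proof -
      have aux: "m < (i + 1) / N \<and> (i + 1) / N \<le> m + 1 / N"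
        if "0 < N" "i \<le> N * m" "N * m < i + 1" for N i m :: real
        using that by (simp add: field_simps)
      have "0 \<le> real (Suc k) * max 0 t" by simp
      then have "real (j k z) = of_int \<lfloor>real (Suc k) * max 0 t\<rfloor>" by (simp add: j_def z)
      then have "real (j k z) \<le> real (Suc k) * max 0 t" "real (Suc k) * max 0 t < real (j k z) + 1"
        by linarith+
      then show "max 0 t < \<theta> k (j k z)" "\<theta> k (j k z) \<le> max 0 t + 1 / real (Suc k)"
        using aux[of "real (Suc k)" "real (j k z)" "max 0 t"] by (simp_all add: \<theta>_def add.commute)
    qed
    have lim: "(\<lambda>k. \<theta> k (j k z)) \<longlonglongrightarrow> max 0 t"
    proof (rule tendsto_sandwich)
      show "eventually (\<lambda>k. max 0 t \<le> \<theta> k (j k z)) sequentially" using le by (simp add: less_imp_le)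
      show "eventually (\<lambda>k. \<theta> k (j k z) \<le> max 0 t + 1 / real (Suc k)) sequentially" using le by simp
      show "(\<lambda>k. max 0 t + 1 / real (Suc k)) \<longlonglongrightarrow> max 0 t"
        using tendsto_add[OF tendsto_const LIMSEQ_inverse_real_of_nat, of "max 0 t"]
        by (simp add: inverse_eq_divide)
    qed simp
    have "filterlim (\<lambda>k. \<theta> k (j k z)) (at_right (max 0 t)) sequentially"
      unfolding filterlim_at
    proof (intro conjI always_eventually allI)
      show "\<theta> k (j k z) \<in> {max 0 t<..}" "\<theta> k (j k z) \<noteq> max 0 t" for k using le(1)[of k] by (simp, metis less_irrefl)
    qed (fact lim)
    from filterlim_compose[OF skorohod_right_continuous[OF \<rho> f01] this]
    show "(\<lambda>k. \<integral>x. f x \<partial>(fst z (\<theta> k (j k z)))) \<longlonglongrightarrow> (\<integral>x. f x \<partial>(case z of (\<rho>, t) \<Rightarrow> \<rho> (max 0 t)))"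
      by (simp add: z)
  qed
qed

lemma measurable_path:
  fixes t :: "'z \<Rightarrow> real"
  assumes \<rho>: "R \<in> N \<rightarrow>\<^sub>M Q" and t: "t \<in> borel_measurable N" and nn: "\<And>z. z \<in> space N \<Longrightarrow> 0 \<le> t z"
  shows "(\<lambda>z. R z (t z)) \<in> N \<rightarrow>\<^sub>M prob_algebra unit_borel"
proof -
  have "(\<lambda>z. (R z, t z)) \<in> N \<rightarrow>\<^sub>M Q \<Otimes>\<^sub>M borel" using \<rho> t by (rule measurable_Pair)
  from measurable_compose[OF this measurable_path_joint]
  have "(\<lambda>z. R z (max 0 (t z))) \<in> N \<rightarrow>\<^sub>M prob_algebra unit_borel" by simp
  also have "?this \<longleftrightarrow> ?thesis" by (rule measurable_cong) (simp add: nn)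
  finally show ?thesis .
qed

end


section \<open>Eves outside regime CDI\<close>

text \<open>Integer times already force uniqueness, since two points cannot both carry more than
  half of the remaining mass, and they keep the condition on a given point countable. Without a
  candidate the value is the unspecified \<open>THE a. False\<close>.\<close>

definition next_eve :: "real set \<Rightarrow> (real \<Rightarrow> real measure) \<Rightarrow> real" where
  "next_eve S \<rho> = (THE a. a \<in> {0..1} - S \<and>
     (\<lambda>n. measure (\<rho> (real n)) {a} / measure (\<rho> (real n)) ({0..1} - S)) \<longlonglongrightarrow> 1)"

primrec eve_set :: "nat \<Rightarrow> (real \<Rightarrow> real measure) \<Rightarrow> real set" where
  "eve_set 0 \<rho> = {}"
| "eve_set (Suc i) \<rho> = insert (next_eve (eve_set i \<rho>) \<rho>) (eve_set i \<rho>)"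

text \<open>Counted from \<open>0\<close>: \<open>eve i\<close> corresponds to the Eve of index
  \<open>Suc i\<close>, and \<open>eve_set i\<close> collects the earlier ones.\<close>

definition eve :: "nat \<Rightarrow> (real \<Rightarrow> real measure) \<Rightarrow> real" where
  "eve i \<rho> = next_eve (eve_set i \<rho>) \<rho>"

definition eve_ratio :: "nat \<Rightarrow> (real \<Rightarrow> real measure) \<Rightarrow> real \<Rightarrow> real" where
  "eve_ratio i \<rho> t = measure (\<rho> t) {eve i \<rho>} / measure (\<rho> t) ({0..1} - eve_set i \<rho>)"

lemma eve_set_eq: "eve_set i \<rho> = (\<lambda>j. eve j \<rho>) ` {..<i}"
  by (induction i) (simp_all add: eve_def lessThan_Suc)

lemma finite_eve_set: "finite (eve_set i \<rho>)"
  by (simp add: eve_set_eq)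

lemma next_eve_candidate_unique:
  assumes \<rho>: "\<rho> \<in> skorohod_space" and S: "finite S"
    and a: "a \<in> {0..1} - S" "(\<lambda>n. measure (\<rho> (real n)) {a} / measure (\<rho> (real n)) ({0..1} - S)) \<longlonglongrightarrow> 1"
    and b: "b \<in> {0..1} - S" "(\<lambda>n. measure (\<rho> (real n)) {b} / measure (\<rho> (real n)) ({0..1} - S)) \<longlonglongrightarrow> 1"
  shows "a = b"
proof (rule ccontr)
  assume "a \<noteq> b"
  let ?m = "\<lambda>n. measure (\<rho> (real n)) ({0..1} - S)"
  have "eventually (\<lambda>n. 1 / 2 < measure (\<rho> (real n)) {a} / ?m n) sequentially"
    "eventually (\<lambda>n. 1 / 2 < measure (\<rho> (real n)) {b} / ?m n) sequentially"
    by (rule order_tendstoD(1)[OF a(2)], simp) (rule order_tendstoD(1)[OF b(2)], simp)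
  then have "eventually (\<lambda>n. 1 / 2 < measure (\<rho> (real n)) {a} / ?m n \<and>
      1 / 2 < measure (\<rho> (real n)) {b} / ?m n) sequentially"
    by (rule eventually_conj)
  then obtain n where n: "1 / 2 < measure (\<rho> (real n)) {a} / ?m n" "1 / 2 < measure (\<rho> (real n)) {b} / ?m n"
    using eventually_happens'[OF sequentially_bot] by blast
  have M1: "\<rho> (real n) \<in> M1" using skorohod_space_M1[OF \<rho>] by simp
  interpret prob_space "\<rho> (real n)" using M1_D(1)[OF M1] .
  note sets = M1_D(2)[OF M1, of a] M1_D(2)[OF M1, of b] M1_D(3)[OF M1 S]
  have "measure (\<rho> (real n)) {a} + measure (\<rho> (real n)) {b} = measure (\<rho> (real n)) ({a} \<union> {b})"
    using sets a b \<open>a \<noteq> b\<close> by (subst finite_measure_Union) auto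
  also have "\<dots> \<le> ?m n"
    using sets a b by (intro finite_measure_mono) auto
  finally have le: "measure (\<rho> (real n)) {a} + measure (\<rho> (real n)) {b} \<le> ?m n" .
  \<comment> \<open>Division by \<open>0\<close> gives \<open>0\<close>, so a ratio above
    \<open>1 / 2\<close> excludes a vanishing denominator.\<close>
  have "?m n \<noteq> 0" using n(1) by auto
  then have "0 < ?m n" using measure_nonneg[of "\<rho> (real n)" "{0..1} - S"] by linarith
  then show False using le n by (simp add: field_simps)
qed

lemma next_eve_eqI:
  assumes "\<rho> \<in> skorohod_space" "finite S" "a \<in> {0..1} - S"
    "(\<lambda>n. measure (\<rho> (real n)) {a} / measure (\<rho> (real n)) ({0..1} - S)) \<longlonglongrightarrow> 1"
  shows "next_eve S \<rho> = a"
  unfolding next_eve_def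
  by (rule the_equality) (use assms next_eve_candidate_unique[OF assms(1,2)] in blast)+

text \<open>By strong induction a sequence of Eves agrees with the recursive one: its next term lies
  outside the earlier ones by distinctness, so it is the candidate that \<open>next_eve\<close>
  picks. The limit of \<open>eve_ratio\<close> is required along all real times, because the integer
  times that select the candidate do not by themselves give it.\<close>

lemma Eves_nonCDI_iff:
  assumes \<rho>: "\<rho> \<in> skorohod_space" and e: "e \<in> {1..} \<rightarrow>\<^sub>E {0..1}"
  shows "Eves_nonCDI \<rho> e \<longleftrightarrow> (\<forall>i. e (Suc i) = eve i \<rho> \<and> (eve_ratio i \<rho> \<longlongrightarrow> 1) at_top)"
proof
  assume E: "Eves_nonCDI \<rho> e"
  have lim: "((\<lambda>t. measure (\<rho> t) {e (Suc i)} / measure (\<rho> t) ({0..1} - e ` {1..<Suc i})) \<longlongrightarrow> 1) at_top" for i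
    using E by (simp add: Eves_nonCDI_def)
  have eq: "e (Suc i) = eve i \<rho> \<and> eve_set i \<rho> = e ` {1..<Suc i}" for i
  proof (induction i rule: less_induct)
    case (less i)
    have "eve_set i \<rho> = (\<lambda>j. e (Suc j)) ` {..<i}"
      unfolding eve_set_eq using less by (intro image_cong) auto
    also have "\<dots> = e ` {1..<Suc i}"
      by (simp add: image_image[symmetric, of e Suc] lessThan_atLeast0)
    finally have S: "eve_set i \<rho> = e ` {1..<Suc i}" .
    have "eve i \<rho> = e (Suc i)"
      unfolding eve_def
    proof (rule next_eve_eqI[OF \<rho> finite_eve_set])
      show "e (Suc i) \<in> {0..1} - eve_set i \<rho>"
        using Eves_nonCDI_distinct[OF E skorohod_space_M1[OF \<rho>] e, of "Suc i"] e
        by (auto simp: S PiE_iff)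
      show "(\<lambda>n. measure (\<rho> (real n)) {e (Suc i)} / measure (\<rho> (real n)) ({0..1} - eve_set i \<rho>)) \<longlonglongrightarrow> 1"
        unfolding S by (rule filterlim_compose[OF lim filterlim_real_sequentially])
    qed
    then show ?case using S by simp
  qed
  show "\<forall>i. e (Suc i) = eve i \<rho> \<and> (eve_ratio i \<rho> \<longlongrightarrow> 1) at_top"
  proof
    fix i
    show "e (Suc i) = eve i \<rho> \<and> (eve_ratio i \<rho> \<longlongrightarrow> 1) at_top"
      using lim[of i] unfolding eve_ratio_def[abs_def] using eq[of i] by simp
  qed
next
  assume A: "\<forall>i. e (Suc i) = eve i \<rho> \<and> (eve_ratio i \<rho> \<longlongrightarrow> 1) at_top"
  show "Eves_nonCDI \<rho> e"
    unfolding Eves_nonCDI_def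
  proof (intro allI impI)
    fix i :: nat assume "1 \<le> i"
    then obtain j where i: "i = Suc j" by (cases i) auto
    have "eve_set j \<rho> = (\<lambda>k. e (Suc k)) ` {..<j}" unfolding eve_set_eq using A by simp
    also have "\<dots> = e ` {1..<Suc j}"
      by (simp add: image_image[symmetric, of e Suc] lessThan_atLeast0)
    finally have "eve_ratio j \<rho> = (\<lambda>t. measure (\<rho> t) {e i} / measure (\<rho> t) ({0..1} - e ` {1..<i}))"
      using A by (simp add: i eve_ratio_def[abs_def])
    then show "((\<lambda>t. measure (\<rho> t) {e i} / measure (\<rho> t) ({0..1} - e ` {1..<i})) \<longlongrightarrow> 1) at_top"
      using A by metis
  qed
qed

text \<open>Only \<open>t\<close> remains as an uncountable quantifier, and it is innermost and
  universal, the form that \<open>measurable_projection_all\<close> accepts.\<close>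

lemma tendsto_at_top_iff_nat:
  fixes f :: "real \<Rightarrow> real"
  shows "(f \<longlongrightarrow> l) at_top \<longleftrightarrow> (\<forall>k::nat. \<exists>N::nat. \<forall>t. real N \<le> t \<longrightarrow> \<bar>f t - l\<bar> < 1 / real (Suc k))"
proof
  assume "(f \<longlongrightarrow> l) at_top"
  then have "eventually (\<lambda>t. \<bar>f t - l\<bar> < 1 / real (Suc k)) at_top" for k
    using tendstoD[of f l at_top "1 / real (Suc k)"] by (simp add: dist_real_def)
  then show "\<forall>k::nat. \<exists>N::nat. \<forall>t. real N \<le> t \<longrightarrow> \<bar>f t - l\<bar> < 1 / real (Suc k)"
    unfolding eventually_at_top_linorder by (meson order_trans real_arch_simple)
next
  assume A: "\<forall>k::nat. \<exists>N::nat. \<forall>t. real N \<le> t \<longrightarrow> \<bar>f t - l\<bar> < 1 / real (Suc k)"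
  show "(f \<longlongrightarrow> l) at_top"
  proof (rule tendstoI)
    fix \<epsilon> :: real assume "0 < \<epsilon>"
    then obtain k where k: "1 / real (Suc k) < \<epsilon>" using nat_approx_posE by blast
    obtain N where "\<forall>t. real N \<le> t \<longrightarrow> \<bar>f t - l\<bar> < 1 / real (Suc k)" using A by blast
    then show "eventually (\<lambda>t. dist (f t) l < \<epsilon>) at_top"
      unfolding eventually_at_top_linorder dist_real_def using k less_trans by blast
  qed
qed

section \<open>Measurable selection of the successive Eves by projection\<close>

context skorohod_measure
begin

text \<open>As a candidate is unique, \<open>next_eve\<close> lies in \<open>B\<close> exactly if
  some candidate does, and this existential statement is measurable by projection. The paths without
  a candidate are counted in or out as a whole, according to the constant
  \<open>THE a. False\<close>.\<close>

lemma next_eve_measurable: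
  assumes S: "Measurable.pred (Q \<Otimes>\<^sub>M borel) (\<lambda>(\<rho>, x). x \<in> S \<rho>)"
    and fin: "\<And>\<rho>. finite (S \<rho>)"
  shows "(\<lambda>\<rho>. next_eve (S \<rho>) \<rho>) \<in> borel_measurable Q"
proof -
  define cand where "cand \<rho> a \<longleftrightarrow> a \<in> {0..1} - S \<rho> \<and>
    (\<lambda>n. measure (\<rho> (real n)) {a} / measure (\<rho> (real n)) ({0..1} - S \<rho>)) \<longlonglongrightarrow> 1" for \<rho> a
  let ?N = "Q \<Otimes>\<^sub>M (borel :: real measure)"
  note [measurable] = S
  have K: "(\<lambda>z. fst z (real n)) \<in> ?N \<rightarrow>\<^sub>M prob_algebra unit_borel" for n
    by (rule measurable_path) auto
  have num [measurable]: "(\<lambda>z. measure (fst z (real n)) ({0..1} \<inter> {snd z})) \<in> borel_measurable ?N" for n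
    by (rule measurable_measure_section[OF K]) simp
  have "Measurable.pred (?N \<Otimes>\<^sub>M borel) (\<lambda>(z, x). (case (fst z, x) of (\<rho>, x) \<Rightarrow> x \<in> S \<rho>))"
    by measurable
  then have den [measurable]: "(\<lambda>z. measure (fst z (real n)) ({0..1} \<inter> - S (fst z))) \<in> borel_measurable ?N" for n
    by (intro measurable_measure_section[OF K]) (simp add: split_beta')
  have "Measurable.pred ?N (\<lambda>z. snd z \<in> {0..1} \<and> \<not> (case z of (\<rho>, x) \<Rightarrow> x \<in> S \<rho>) \<and>
     (\<lambda>n. measure (fst z (real n)) ({0..1} \<inter> {snd z}) / measure (fst z (real n)) ({0..1} \<inter> - S (fst z))) \<longlonglongrightarrow> 1)"
    by measurable
  also have "(\<lambda>z. snd z \<in> {0..1} \<and> \<not> (case z of (\<rho>, x) \<Rightarrow> x \<in> S \<rho>) \<and>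
     (\<lambda>n. measure (fst z (real n)) ({0..1} \<inter> {snd z}) / measure (fst z (real n)) ({0..1} \<inter> - S (fst z))) \<longlonglongrightarrow> 1)
     = (\<lambda>(\<rho>, a). cand \<rho> a)"
    by (auto simp: fun_eq_iff cand_def Diff_eq Int_absorb1 Int_absorb2)
  finally have cand [measurable]: "Measurable.pred ?N (\<lambda>(\<rho>, a). cand \<rho> a)" .
  show ?thesis
  proof (rule measurableI)
    fix B :: "real set" assume B [measurable]: "B \<in> sets borel"
    have [measurable]: "Measurable.pred ?N (\<lambda>(\<rho>, a). cand \<rho> a \<and> a \<in> B)"
      using pred_intros_logic(3)[OF cand, of "\<lambda>z. snd z \<in> B"] by (simp add: split_beta')
    have "Measurable.pred Q (\<lambda>\<rho>. (\<exists>a. cand \<rho> a \<and> a \<in> B) \<or> (\<not> (\<exists>a. cand \<rho> a) \<and> (THE a. False) \<in> B))"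
      by (intro pred_intros_logic measurable_projection[OF finite_measure_axioms] measurable_const)
         (simp_all add: measurable cand)
    then have "{\<rho> \<in> space Q. (\<exists>a. cand \<rho> a \<and> a \<in> B) \<or> (\<not> (\<exists>a. cand \<rho> a) \<and> (THE a. False) \<in> B)} \<in> sets Q"
      by (simp add: pred_def)
    also have "{\<rho> \<in> space Q. (\<exists>a. cand \<rho> a \<and> a \<in> B) \<or> (\<not> (\<exists>a. cand \<rho> a) \<and> (THE a. False) \<in> B)}
        = (\<lambda>\<rho>. next_eve (S \<rho>) \<rho>) -` B \<inter> space Q"
    proof (intro set_eqI)
      fix \<rho>
      show "\<rho> \<in> {\<rho> \<in> space Q. (\<exists>a. cand \<rho> a \<and> a \<in> B) \<or> (\<not> (\<exists>a. cand \<rho> a) \<and> (THE a. False) \<in> B)}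
        \<longleftrightarrow> \<rho> \<in> (\<lambda>\<rho>. next_eve (S \<rho>) \<rho>) -` B \<inter> space Q"
      proof (cases "\<exists>a. cand \<rho> a")
        case True
        then obtain a where a: "cand \<rho> a" by blast
        have "next_eve (S \<rho>) \<rho> = b" if "\<rho> \<in> space Q" "cand \<rho> b" for b
          using that by (intro next_eve_eqI[OF _ fin]) (auto simp: cand_def space_Q)
        then show ?thesis using a by auto
      next
        case False
        then have "(\<lambda>a. cand \<rho> a) = (\<lambda>a. False)" by blast
        then have "next_eve (S \<rho>) \<rho> = (THE a. False)"
          unfolding next_eve_def cand_def by (rule arg_cong)
        then show ?thesis using False by auto
      qed
    qed
    finally show "(\<lambda>\<rho>. next_eve (S \<rho>) \<rho>) -` B \<inter> space Q \<in> sets Q" .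
  qed simp
qed

lemma eve_set_measurable: "Measurable.pred (Q \<Otimes>\<^sub>M borel) (\<lambda>(\<rho>, x). x \<in> eve_set i \<rho>)"
proof (induction i)
  case (Suc i)
  note [measurable] = Suc next_eve_measurable[OF Suc finite_eve_set]
  have "Measurable.pred (Q \<Otimes>\<^sub>M borel) (\<lambda>z. snd z = next_eve (eve_set i (fst z)) (fst z) \<or> (case z of (\<rho>, x) \<Rightarrow> x \<in> eve_set i \<rho>))"
    by measurable
  then show ?case by (simp add: split_beta')
qed simp

lemma eve_measurable [measurable]: "eve i \<in> borel_measurable Q"
  unfolding eve_def[abs_def] by (rule next_eve_measurable[OF eve_set_measurable finite_eve_set])

lemma eve_ratio_tendsto_measurable:
  "Measurable.pred Q (\<lambda>\<rho>. eve i \<rho> \<in> {0..1} \<and> (eve_ratio i \<rho> \<longlongrightarrow> 1) at_top)"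
proof -
  let ?N = "Q \<Otimes>\<^sub>M (borel :: real measure)"
  \<comment> \<open>A version of \<open>eve_ratio\<close> defined for all real times, with both sets
    cut to the unit interval. It agrees with \<open>eve_ratio\<close> for \<open>t \<ge> 0\<close>
    once \<open>eve i \<rho>\<close> lies in \<open>{0..1}\<close>.\<close>
  define r where "r z = measure (fst z (max 0 (snd z))) ({0..1} \<inter> {eve i (fst z)})
      / measure (fst z (max 0 (snd z))) ({0..1} \<inter> - eve_set i (fst z))" for z
  have K: "(\<lambda>z. fst z (max 0 (snd z))) \<in> ?N \<rightarrow>\<^sub>M prob_algebra unit_borel"
    by (rule measurable_path) auto
  note [measurable] = eve_set_measurable
  have "Measurable.pred (?N \<Otimes>\<^sub>M borel) (\<lambda>(z, x). (case (fst z, x) of (\<rho>, x) \<Rightarrow> x \<in> eve_set i \<rho>))"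
    by measurable
  then have [measurable]: "(\<lambda>z. measure (fst z (max 0 (snd z))) ({0..1} \<inter> - eve_set i (fst z))) \<in> borel_measurable ?N"
    by (intro measurable_measure_section[OF K]) (simp add: split_beta')
  have [measurable]: "(\<lambda>z. measure (fst z (max 0 (snd z))) ({0..1} \<inter> {eve i (fst z)})) \<in> borel_measurable ?N"
    by (intro measurable_measure_section[OF K]) simp
  have [measurable]: "r \<in> borel_measurable ?N" unfolding r_def[abs_def] by measurable
  have "Measurable.pred Q (\<lambda>\<rho>. eve i \<rho> \<in> {0..1} \<and>
      (\<forall>k::nat. \<exists>N::nat. \<forall>t. real N \<le> t \<longrightarrow> \<bar>r (\<rho>, t) - 1\<bar> < 1 / real (Suc k)))"
  proof (intro pred_intros_logic pred_intros_countable measurable_projection_all[OF finite_measure_axioms])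
    show "Measurable.pred Q (\<lambda>\<rho>. eve i \<rho> \<in> {0..1})" by measurable
    show "Measurable.pred ?N (\<lambda>(\<rho>, t). real n \<le> t \<longrightarrow> \<bar>r (\<rho>, t) - 1\<bar> < 1 / real (Suc k))" for k n :: nat
      by measurable
  qed
  also have "(\<lambda>\<rho>. eve i \<rho> \<in> {0..1} \<and>
      (\<forall>k::nat. \<exists>N::nat. \<forall>t. real N \<le> t \<longrightarrow> \<bar>r (\<rho>, t) - 1\<bar> < 1 / real (Suc k)))
      = (\<lambda>\<rho>. eve i \<rho> \<in> {0..1} \<and> (eve_ratio i \<rho> \<longlongrightarrow> 1) at_top)"
  proof
    fix \<rho>
    show "(eve i \<rho> \<in> {0..1} \<and>
      (\<forall>k::nat. \<exists>N::nat. \<forall>t. real N \<le> t \<longrightarrow> \<bar>r (\<rho>, t) - 1\<bar> < 1 / real (Suc k)))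
      = (eve i \<rho> \<in> {0..1} \<and> (eve_ratio i \<rho> \<longlongrightarrow> 1) at_top)"
    proof (rule conj_cong[OF refl])
      assume "eve i \<rho> \<in> {0..1}"
      then have "r (\<rho>, t) = eve_ratio i \<rho> t" if "0 \<le> t" for t
        using that by (simp add: r_def eve_ratio_def Diff_eq Int_absorb1 max_def)
      moreover have "0 \<le> t" if "real N \<le> t" for N t using that of_nat_0_le_iff order_trans by blast
      ultimately show "(\<forall>k::nat. \<exists>N::nat. \<forall>t. real N \<le> t \<longrightarrow> \<bar>r (\<rho>, t) - 1\<bar> < 1 / real (Suc k))
        \<longleftrightarrow> (eve_ratio i \<rho> \<longlongrightarrow> 1) at_top"
        unfolding tendsto_at_top_iff_nat by simp
    qed
  qed
  finally show ?thesis .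
qed

lemma admits_Eves_nonCDI_measurable:
  assumes "\<not> CDI \<Lambda>"
  shows "{\<rho> \<in> skorohod_space. admits_Eves \<Lambda> \<rho>} \<in> sets Q"
proof -
  have "{\<rho> \<in> skorohod_space. admits_Eves \<Lambda> \<rho>} =
      {\<rho> \<in> space Q. \<forall>i. eve i \<rho> \<in> {0..1} \<and> (eve_ratio i \<rho> \<longlongrightarrow> 1) at_top}"
  proof (intro set_eqI iffI)
    fix \<rho> assume "\<rho> \<in> {\<rho> \<in> skorohod_space. admits_Eves \<Lambda> \<rho>}"
    then obtain e where \<rho>: "\<rho> \<in> skorohod_space" and e: "e \<in> {1..} \<rightarrow>\<^sub>E {0..1}" and "Eves_nonCDI \<rho> e"
      using assms by (auto simp: admits_Eves_def is_Eves_def)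
    then have "e (Suc i) = eve i \<rho> \<and> (eve_ratio i \<rho> \<longlongrightarrow> 1) at_top" for i
      using Eves_nonCDI_iff[OF \<rho> e] by blast
    moreover have "e (Suc i) \<in> {0..1}" for i using e by (rule PiE_mem) simp
    ultimately show "\<rho> \<in> {\<rho> \<in> space Q. \<forall>i. eve i \<rho> \<in> {0..1} \<and> (eve_ratio i \<rho> \<longlongrightarrow> 1) at_top}"
      using \<rho> space_Q by auto
  next
    fix \<rho> assume "\<rho> \<in> {\<rho> \<in> space Q. \<forall>i. eve i \<rho> \<in> {0..1} \<and> (eve_ratio i \<rho> \<longlongrightarrow> 1) at_top}"
    then have \<rho>: "\<rho> \<in> skorohod_space" and *: "\<And>i. eve i \<rho> \<in> {0..1}" "\<And>i. (eve_ratio i \<rho> \<longlongrightarrow> 1) at_top"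
      by (auto simp: space_Q)
    define e where "e = (\<lambda>i\<in>{1..}. eve (i - 1) \<rho>)"
    have e: "e \<in> {1..} \<rightarrow>\<^sub>E {0..1}" unfolding e_def using *(1) by (intro restrict_PiE_iff[THEN iffD2]) blast
    have "Eves_nonCDI \<rho> e" unfolding Eves_nonCDI_iff[OF \<rho> e] using *(2) by (simp add: e_def)
    then show "\<rho> \<in> {\<rho> \<in> skorohod_space. admits_Eves \<Lambda> \<rho>}"
      using assms e \<rho> by (auto simp: admits_Eves_def is_Eves_def)
  qed
  moreover have "Measurable.pred Q (\<lambda>\<rho>. \<forall>i. eve i \<rho> \<in> {0..1} \<and> (eve_ratio i \<rho> \<longlongrightarrow> 1) at_top)"
    by (rule pred_intros_countable(1)) (rule eve_ratio_tendsto_measurable)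
  ultimately show ?thesis by (simp add: pred_def)
qed

lemma Eves_nonCDI_eq:
  assumes "\<not> CDI \<Lambda>" "\<rho> \<in> skorohod_space" "admits_Eves \<Lambda> \<rho>" "1 \<le> i"
  shows "Eves \<Lambda> \<rho> i = eve (i - 1) \<rho>"
proof -
  obtain e where e: "is_Eves \<Lambda> \<rho> e" using assms by (auto simp: admits_Eves_def)
  then have "e (Suc (i - 1)) = eve (i - 1) \<rho>"
    using Eves_nonCDI_iff[OF assms(2), of e] assms(1) by (simp add: is_Eves_def)
  then show ?thesis using Eves_eq[OF assms(2) e] assms(4) by simp
qed

end


section \<open>Counting atoms\<close>

definition n_atomic :: "nat \<Rightarrow> real measure \<Rightarrow> bool" where
  "n_atomic n \<mu> \<longleftrightarrow> finitely_atomic \<mu> \<and> card (atoms \<mu>) = n"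

definition rat_ivl :: "rat \<times> rat \<Rightarrow> real set" where
  "rat_ivl p = {of_rat (fst p)<..<of_rat (snd p)}"

text \<open>For a measure in \<open>M1\<close> this says that the support has at least
  \<open>n\<close> points. Lists of pairs of rationals form a countable type, so the existential
  quantifier is a countable one; \<open>card (set xs)\<close> ignores repetitions.\<close>

definition charges_disjoint :: "nat \<Rightarrow> real measure \<Rightarrow> bool" where
  "charges_disjoint n \<mu> \<longleftrightarrow> (\<exists>xs. card (set xs) = n \<and>
     (\<forall>p\<in>set xs. \<forall>q\<in>set xs. p \<noteq> q \<longrightarrow> rat_ivl p \<inter> rat_ivl q = {}) \<and>
     (\<forall>p\<in>set xs. 0 < measure \<mu> ({0..1} \<inter> rat_ivl p)))"

lemma rat_ivl_borel [measurable]: "rat_ivl p \<in> sets borel"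
  by (simp add: rat_ivl_def)

lemma M1_sets: "\<mu> \<in> M1 \<Longrightarrow> A \<in> sets \<mu> \<longleftrightarrow> A \<in> sets borel \<and> A \<subseteq> {0..1}"
  by (simp add: M1_iff sets_unit_borel_iff)

text \<open>Intervals that reach less than half the least distance \<open>\<delta>\<close> from
  their points are pairwise disjoint. The lemma is used for the atoms and for finite subsets of the
  support.\<close>

lemma charges_disjoint_points:
  fixes S :: "real set"
  assumes S: "finite S" and pos: "\<And>x p. x \<in> S \<Longrightarrow> of_rat (fst p) < x \<Longrightarrow> x < of_rat (snd p) \<Longrightarrow>
    0 < measure \<mu> ({0..1} \<inter> rat_ivl p)"
  shows "charges_disjoint (card S) \<mu>"
proof -
  \<comment> \<open>The element \<open>1\<close> makes the minimum exist when there are fewer than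
    two points.\<close>
  define D where "D = insert 1 ((\<lambda>(x, y). \<bar>x - y\<bar>) ` {(x, y) \<in> S \<times> S. x \<noteq> y})"
  have "finite {(x, y) \<in> S \<times> S. x \<noteq> y}" using S by (intro finite_subset[OF _ finite_cartesian_product[OF S S]]) auto
  then have D: "finite D" "D \<noteq> {}" by (auto simp: D_def)
  define \<delta> where "\<delta> = Min D"
  have "\<delta> \<in> D" unfolding \<delta>_def using D by (rule Min_in)
  then have d0: "0 < \<delta>" by (auto simp: D_def)
  have dist: "\<delta> \<le> \<bar>x - y\<bar>" if "x \<in> S" "y \<in> S" "x \<noteq> y" for x y
    unfolding \<delta>_def by (rule Min_le[OF D(1)]) (use that in \<open>auto simp: D_def\<close>)
  have "\<exists>p. x - \<delta> / 2 < of_rat (fst p) \<and> of_rat (fst p) < x \<and> x < of_rat (snd p) \<and> of_rat (snd p) < x + \<delta> / 2"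
    for x :: real
  proof -
    obtain q where "x - \<delta> / 2 < of_rat q" "of_rat q < x" using of_rat_dense[of "x - \<delta> / 2" x] d0 by auto
    moreover obtain r where "x < of_rat r" "of_rat r < x + \<delta> / 2" using of_rat_dense[of x "x + \<delta> / 2"] d0 by auto
    ultimately show ?thesis by (intro exI[of _ "(q, r)"]) simp
  qed
  then obtain p where p: "\<And>x. x - \<delta> / 2 < of_rat (fst (p x))" "\<And>x. of_rat (fst (p x)) < x"
    "\<And>x. x < of_rat (snd (p x))" "\<And>x. of_rat (snd (p x)) < x + \<delta> / 2"
    by metis
  have near: "\<bar>z - x\<bar> < \<delta> / 2" if "z \<in> rat_ivl (p x)" for z x
    using that p(1)[of x] p(4)[of x] unfolding rat_ivl_def greaterThanLessThan_iff by linarith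
  have disj: "rat_ivl (p x) \<inter> rat_ivl (p y) = {}" if "x \<in> S" "y \<in> S" "x \<noteq> y" for x y
  proof (rule ccontr)
    assume "rat_ivl (p x) \<inter> rat_ivl (p y) \<noteq> {}"
    then obtain z where "z \<in> rat_ivl (p x)" "z \<in> rat_ivl (p y)" by blast
    then have "\<bar>z - x\<bar> < \<delta> / 2" "\<bar>z - y\<bar> < \<delta> / 2" by (blast intro: near)+
    then show False using dist[OF that] by linarith
  qed
  have self: "x \<in> rat_ivl (p x)" for x using p(2)[of x] p(3)[of x] by (simp add: rat_ivl_def)
  have "inj_on p S"
  proof (rule inj_onI, rule ccontr)
    fix x y assume xy: "x \<in> S" "y \<in> S" "p x = p y" "x \<noteq> y"
    have "rat_ivl (p x) \<inter> rat_ivl (p y) = {}" by (rule disj) fact+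
    moreover have "x \<in> rat_ivl (p y)" using self[of x] unfolding xy(3) .
    ultimately show False using self[of x] by blast
  qed
  then have "card (p ` S) = card S" by (rule card_image)
  moreover obtain xs where "set xs = p ` S" using finite_list[of "p ` S"] S by auto
  moreover have "rat_ivl q \<inter> rat_ivl q' = {}" if "q \<in> p ` S" "q' \<in> p ` S" "q \<noteq> q'" for q q'
    using that disj by (elim imageE) metis
  moreover have "0 < measure \<mu> ({0..1} \<inter> rat_ivl q)" if "q \<in> p ` S" for q
    using that pos p(2,3) by blast
  ultimately show ?thesis
    unfolding charges_disjoint_def by (intro exI[of _ xs]) simp
qed

lemma finitely_atomic_finite: "finitely_atomic \<mu> \<Longrightarrow> finite (atoms \<mu>)"
  unfolding finitely_atomic_def by (rule conjunct1)

text \<open>Each charged interval contains an atom, and disjointness of the intervals makes the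
  choice of atoms injective.\<close>

lemma finitely_atomic_charges_le:
  assumes \<mu>: "\<mu> \<in> M1" and fa: "finitely_atomic \<mu>" and "charges_disjoint n \<mu>"
  shows "n \<le> card (atoms \<mu>)"
proof -
  obtain xs where xs: "card (set xs) = n"
    "\<forall>p\<in>set xs. \<forall>q\<in>set xs. p \<noteq> q \<longrightarrow> rat_ivl p \<inter> rat_ivl q = {}"
    "\<forall>p\<in>set xs. 0 < measure \<mu> ({0..1} \<inter> rat_ivl p)"
    using assms(3) unfolding charges_disjoint_def by (elim exE conjE)
  have "\<exists>a. a \<in> atoms \<mu> \<and> a \<in> rat_ivl p" if "p \<in> set xs" for p
  proof (rule ccontr)
    assume "\<not> ?thesis"
    then have "atoms \<mu> \<inter> ({0..1} \<inter> rat_ivl p) = {}" by blast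
    moreover have "{0..1} \<inter> rat_ivl p \<in> sets \<mu>" unfolding M1_sets[OF \<mu>] by auto
    then have "measure \<mu> ({0..1} \<inter> rat_ivl p) = (\<Sum>a\<in>atoms \<mu> \<inter> ({0..1} \<inter> rat_ivl p). measure \<mu> {a})"
      using fa unfolding finitely_atomic_def by blast
    ultimately show False using xs(3)[rule_format, OF that] by simp
  qed
  then obtain g where g: "\<And>p. p \<in> set xs \<Longrightarrow> g p \<in> atoms \<mu> \<and> g p \<in> rat_ivl p" by metis
  have "inj_on g (set xs)"
  proof (rule inj_onI, rule ccontr)
    fix p q assume "p \<in> set xs" "q \<in> set xs" "g p = g q" "p \<noteq> q"
    then show False using xs(2)[rule_format, of p q] g[of p] g[of q] by auto
  qed
  then have "card (set xs) \<le> card (atoms \<mu>)"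
    by (rule card_inj_on_le) (use g finitely_atomic_finite[OF fa] in blast)+
  then show ?thesis unfolding xs(1) .
qed

lemma finitely_atomic_charges:
  assumes \<mu>: "\<mu> \<in> M1" and fa: "finitely_atomic \<mu>"
  shows "charges_disjoint (card (atoms \<mu>)) \<mu>"
proof (rule charges_disjoint_points)
  show "finite (atoms \<mu>)" by (rule finitely_atomic_finite[OF fa])
  fix x p assume x: "x \<in> atoms \<mu>" and p: "of_rat (fst p) < x" "x < of_rat (snd p)"
  interpret prob_space \<mu> using \<mu> by (simp add: M1_iff)
  have "measure \<mu> {x} \<le> measure \<mu> ({0..1} \<inter> rat_ivl p)"
    by (rule finite_measure_mono) (use x p M1_sets[OF \<mu>] in \<open>auto simp: atoms_def rat_ivl_def\<close>)
  then show "0 < measure \<mu> ({0..1} \<inter> rat_ivl p)" using x by (simp add: atoms_def)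
qed

lemma charges_disjoint_mono:
  assumes "charges_disjoint n \<mu>" "m \<le> n"
  shows "charges_disjoint m \<mu>"
proof -
  obtain xs where xs: "card (set xs) = n"
    "\<forall>p\<in>set xs. \<forall>q\<in>set xs. p \<noteq> q \<longrightarrow> rat_ivl p \<inter> rat_ivl q = {}"
    "\<forall>p\<in>set xs. 0 < measure \<mu> ({0..1} \<inter> rat_ivl p)"
    using assms(1) unfolding charges_disjoint_def by (elim exE conjE)
  obtain T where T: "T \<subseteq> set xs" "card T = m" "finite T"
    using obtain_subset_with_card_n[of m "set xs"] assms(2) xs(1) by metis
  obtain ys where "set ys = T" using finite_list[OF T(3)] by blast
  then have "card (set ys) = m" "\<And>p. p \<in> set ys \<Longrightarrow> p \<in> set xs" using T by auto
  then show ?thesis unfolding charges_disjoint_def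
    using xs(2,3) by (intro exI[of _ ys] conjI ballI impI) blast+
qed

text \<open>The assumption leaves at most \<open>n\<close> points in the support. The rest of the
  unit interval is covered by countably many rational intervals of mass \<open>0\<close>, so the
  measure is carried by a finite set.\<close>

lemma not_charges_finitely_atomic:
  assumes \<mu>: "\<mu> \<in> M1" and n: "\<not> charges_disjoint (Suc n) \<mu>"
  shows "finitely_atomic \<mu>"
proof -
  interpret prob_space \<mu> using \<mu> by (simp add: M1_iff)
  \<comment> \<open>The topological support, tested on rational neighbourhoods.\<close>
  define supp where "supp = {x \<in> {0..1 :: real}. \<forall>p. of_rat (fst p) < x \<and> x < of_rat (snd p) \<longrightarrow>
    0 < measure \<mu> ({0..1} \<inter> rat_ivl p)}"
  have small: "card T \<noteq> Suc n" if "T \<subseteq> supp" "finite T" for T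
  proof
    assume "card T = Suc n"
    moreover have "charges_disjoint (card T) \<mu>"
      by (rule charges_disjoint_points[OF that(2)]) (use that(1) in \<open>auto simp: supp_def\<close>)
    ultimately show False using n by simp
  qed
  have fin: "finite supp"
    using small infinite_arbitrarily_large[of supp "Suc n"] by blast
  define Z where "Z = (\<Union>p\<in>{p. measure \<mu> ({0..1} \<inter> rat_ivl p) = 0}. {0..1} \<inter> rat_ivl p)"
  have Z: "Z \<in> null_sets \<mu>"
    unfolding Z_def
  proof (rule null_sets_UN')
    fix p assume "p \<in> {p. measure \<mu> ({0..1} \<inter> rat_ivl p) = 0}"
    then show "{0..1} \<inter> rat_ivl p \<in> null_sets \<mu>"
      using M1_sets[OF \<mu>] by (intro null_setsI) (auto simp: emeasure_eq_measure)
  qed simp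
  have compl: "{0..1} - supp \<subseteq> Z"
  proof
    fix x assume "x \<in> {0..1} - supp"
    then obtain p where "x \<in> {0..1}" "of_rat (fst p) < x" "x < of_rat (snd p)"
      "\<not> 0 < measure \<mu> ({0..1} \<inter> rat_ivl p)"
      unfolding supp_def by blast
    then show "x \<in> Z" unfolding Z_def rat_ivl_def
      by (intro UN_I[of p]) (auto simp: zero_less_measure_iff)
  qed
  have null: "measure \<mu> B = 0" if "B \<in> sets \<mu>" "B \<inter> supp = {}" for B
  proof -
    have "B \<subseteq> {0..1}" using that(1) M1_sets[OF \<mu>, of B] by simp
    then have "B \<subseteq> Z" using that(2) compl by blast
    then have "B \<in> null_sets \<mu>" using null_sets_subset[OF Z that(1)] by blast
    then show ?thesis by (simp add: measure_eq_0_null_sets)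
  qed
  have single: "{a} \<in> sets \<mu>" if "a \<in> {0..1}" for a using that M1_sets[OF \<mu>, of "{a}"] by simp
  have sub: "atoms \<mu> \<subseteq> supp"
  proof
    fix a assume a: "a \<in> atoms \<mu>"
    show "a \<in> supp"
    proof (rule ccontr)
      assume "a \<notin> supp"
      then have "measure \<mu> {a} = 0" using a single by (intro null) (auto simp: atoms_def)
      then show False using a by (simp add: atoms_def)
    qed
  qed
  have supp01: "supp \<subseteq> {0..1}" by (auto simp: supp_def)
  have sum: "measure \<mu> B = (\<Sum>a\<in>atoms \<mu> \<inter> B. measure \<mu> {a})" if B: "B \<in> sets \<mu>" for B
  proof -
    have fB: "finite (B \<inter> supp)" using fin by blast
    then have BS: "B \<inter> supp \<in> sets \<mu>"
      using M1_sets[OF \<mu>] supp01 finite_imp_closed[OF fB] by auto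
    have "measure \<mu> B = measure \<mu> (B \<inter> supp) + measure \<mu> (B - supp)"
    proof -
      have "B - supp = B - (B \<inter> supp)" by blast
      then have "B - supp \<in> sets \<mu>" using B BS by auto
      moreover have "B = (B \<inter> supp) \<union> (B - supp)" by blast
      ultimately show ?thesis using finite_measure_Union[OF BS, of "B - supp"] by (metis Diff_disjoint Int_Diff Int_commute inf_left_commute inf_bot_right)
    qed
    also have "measure \<mu> (B - supp) = 0"
    proof (rule null)
      have "B - supp = B - (B \<inter> supp)" by blast
      then show "B - supp \<in> sets \<mu>" using B BS by auto
    qed blast
    also have "measure \<mu> (B \<inter> supp) = (\<Sum>a\<in>B \<inter> supp. measure \<mu> {a})"
      using supp01 single by (intro finite_measure_eq_sum_singleton[OF fB]) blast
    also have "\<dots> = (\<Sum>a\<in>atoms \<mu> \<inter> B. measure \<mu> {a})"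
    proof (rule sum.mono_neutral_right[OF fB])
      show "\<forall>a\<in>B \<inter> supp - atoms \<mu> \<inter> B. measure \<mu> {a} = 0"
        using supp01 by (auto simp: atoms_def zero_less_measure_iff)
    qed (use sub in blast)
    finally show ?thesis by simp
  qed
  show ?thesis unfolding finitely_atomic_def using finite_subset[OF sub fin] sum by blast
qed

text \<open>\<open>\<not> charges_disjoint (Suc n) \<mu>\<close> does double work: it yields finite
  atomicity and it bounds the number of atoms by \<open>n\<close>.\<close>

lemma n_atomic_iff_charges:
  assumes "\<mu> \<in> M1"
  shows "n_atomic n \<mu> \<longleftrightarrow> charges_disjoint n \<mu> \<and> \<not> charges_disjoint (Suc n) \<mu>"
proof
  assume "n_atomic n \<mu>"
  then show "charges_disjoint n \<mu> \<and> \<not> charges_disjoint (Suc n) \<mu>"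
    using finitely_atomic_charges[OF assms] finitely_atomic_charges_le[OF assms, of "Suc n"]
    by (auto simp: n_atomic_def)
next
  assume c: "charges_disjoint n \<mu> \<and> \<not> charges_disjoint (Suc n) \<mu>"
  then have fa: "finitely_atomic \<mu>" using not_charges_finitely_atomic[OF assms] by blast
  have "n \<le> card (atoms \<mu>)" using finitely_atomic_charges_le[OF assms fa] c by blast
  moreover have "\<not> Suc n \<le> card (atoms \<mu>)"
    using charges_disjoint_mono[OF finitely_atomic_charges[OF assms fa]] c by blast
  ultimately show "n_atomic n \<mu>" using fa by (simp add: n_atomic_def)
qed

lemma n_atomic_measurable:
  assumes K: "K \<in> N \<rightarrow>\<^sub>M prob_algebra unit_borel"
  shows "Measurable.pred N (\<lambda>z. n_atomic n (K z))"
proof -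
  have m: "(\<lambda>z. measure (K z) ({0..1} \<inter> rat_ivl p)) \<in> borel_measurable N" for p
    by (rule measurable_measure_section[OF K]) simp
  have c: "Measurable.pred N (\<lambda>z. charges_disjoint n (K z))" for n
    unfolding charges_disjoint_def
    by (intro pred_intros_countable pred_intros_logic pred_intros_finite)
       (use m in \<open>simp_all add: borel_measurable_const borel_measurable_less pred_def\<close>)
  have "Measurable.pred N (\<lambda>z. charges_disjoint n (K z) \<and> \<not> charges_disjoint (Suc n) (K z))"
    by (intro pred_intros_logic c)
  also have "?this \<longleftrightarrow> ?thesis"
  proof (rule measurable_cong)
    fix z assume "z \<in> space N"
    then have "K z \<in> M1" using measurable_space[OF K] by (simp add: M1_def)
    then show "(charges_disjoint n (K z) \<and> \<not> charges_disjoint (Suc n) (K z)) = n_atomic n (K z)"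
      by (simp add: n_atomic_iff_charges)
  qed
  finally show ?thesis .
qed

lemma atom_measurable:
  assumes K: "K \<in> N \<rightarrow>\<^sub>M prob_algebra unit_borel" and a [measurable]: "a \<in> borel_measurable N"
  shows "Measurable.pred N (\<lambda>z. a z \<in> atoms (K z))"
proof -
  have [measurable]: "(\<lambda>z. measure (K z) ({0..1} \<inter> {a z})) \<in> borel_measurable N"
    by (rule measurable_measure_section[OF K]) simp
  have "Measurable.pred N (\<lambda>z. a z \<in> {0..1} \<and> 0 < measure (K z) ({0..1} \<inter> {a z}))" by measurable
  also have "(\<lambda>z. a z \<in> {0..1} \<and> 0 < measure (K z) ({0..1} \<inter> {a z})) = (\<lambda>z. a z \<in> atoms (K z))"
    by (auto simp: atoms_def fun_eq_iff)
  finally show ?thesis .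
qed


section \<open>Eves in regime CDI\<close>

lemma less_extinction_time_iff:
  assumes dec: "\<And>s t. 0 < s \<Longrightarrow> s \<le> t \<Longrightarrow> atoms (\<rho> t) \<subseteq> atoms (\<rho> s)" and "0 < t"
    and "ereal t < extinction_time \<rho> a"
  shows "a \<in> atoms (\<rho> t)"
proof -
  obtain s where s: "t < s" "a \<in> atoms (\<rho> s)"
    using assms(3) unfolding extinction_time_def less_Sup_iff by auto
  then show ?thesis using dec[of t s] \<open>0 < t\<close> by auto
qed

lemma le_extinction_time: "0 < t \<Longrightarrow> a \<in> atoms (\<rho> t) \<Longrightarrow> ereal t \<le> extinction_time \<rho> a"
  unfolding extinction_time_def by (rule Sup_upper) blast

lemma atoms_antimono:
  fixes s t :: real
  assumes "\<And>t s. 0 < t \<Longrightarrow> 0 < s \<Longrightarrow> atoms (\<rho> (t + s)) \<subseteq> atoms (\<rho> t)" "0 < s" "s \<le> t"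
  shows "atoms (\<rho> t) \<subseteq> atoms (\<rho> s)"
  using assms(1)[of s "t - s"] assms(2,3) by (cases "s = t") auto

lemma at_within_pos_lessThan: "0 < t \<Longrightarrow> at t within {0<..} \<inter> {..<t :: real} = at_left t"
  by (rule at_within_nhd[of t "{0<..}"]) auto

lemma initial_segment_eq:
  assumes "finite J" "J \<subseteq> {1..}" "\<And>i j :: nat. 1 \<le> i \<Longrightarrow> i < j \<Longrightarrow> j \<in> J \<Longrightarrow> i \<in> J"
  shows "J = {1..card J}"
proof (cases "J = {}")
  case False
  have m: "Max J \<in> J" using assms(1) False by (rule Max_in)
  have "J = {1..Max J}"
  proof (intro equalityI subsetI)
    fix i assume "i \<in> J" then show "i \<in> {1..Max J}" using assms(2) Max_ge[OF assms(1)] by auto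
  next
    fix i assume "i \<in> {1..Max J}" then show "i \<in> J" using m assms(3)[of i "Max J"] by (cases "i = Max J") auto
  qed
  moreover from this have "card J = Max J" by (metis card_atLeastAtMost diff_Suc_1)
  ultimately show ?thesis by simp
qed simp

lemma eventually_eq_of_nat_limit:
  fixes f :: "real \<Rightarrow> nat"
  assumes lim: "((\<lambda>s. real (f s)) \<longlongrightarrow> l) F" and l: "l = real m"
  shows "eventually (\<lambda>s. f s = m) F"
proof -
  have "eventually (\<lambda>s. dist (real (f s)) l < 1) F" using tendstoD[OF lim] by simp
  then show ?thesis by (rule eventually_mono) (auto simp: l dist_real_def)
qed

text \<open>
  Once the sets of atoms decrease, the limits in the definition of \<open>Eves_CDI\<close> are limits of monotone
  integer-valued functions, so that they can be read off along \<open>t \<plusminus> 1 / (k + 1)\<close>.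
\<close>

definition coming_down :: "(real \<Rightarrow> real measure) \<Rightarrow> bool" where
  "coming_down \<rho> \<longleftrightarrow>
     (\<forall>t. 0 < t \<longrightarrow> (\<exists>n. n_atomic n (\<rho> t))) \<and>
     (\<forall>z. 0 < fst z \<and> 0 < fst (snd z) \<and> snd (snd z) \<in> atoms (\<rho> (fst z + fst (snd z))) \<longrightarrow>
        snd (snd z) \<in> atoms (\<rho> (fst z))) \<and>
     (\<forall>t. 0 < t \<longrightarrow> (\<exists>n k. n_atomic n (\<rho> t) \<and> n_atomic n (\<rho> (t + 1 / real (Suc k))))) \<and>
     (\<forall>t. 0 < t \<longrightarrow> (\<exists>n k. 1 / real (Suc k) < t \<and> n_atomic n (\<rho> t) \<and>
        (n_atomic n (\<rho> (t - 1 / real (Suc k))) \<or> n_atomic (Suc n) (\<rho> (t - 1 / real (Suc k)))))) \<and>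
     (\<forall>n. \<exists>t. 0 < t \<and> n_atomic (Suc n) (\<rho> t))"

text \<open>Counted from \<open>0\<close>, so that it describes the Eve of index
  \<open>Suc i\<close>. The pair \<open>z\<close> holds a time of presence and a time of absence.
  For \<open>i = 0\<close> no time of absence is asked, since a finitely atomic probability measure
  never has \<open>0\<close> atoms.\<close>

definition nth_eve :: "(real \<Rightarrow> real measure) \<Rightarrow> nat \<Rightarrow> real \<Rightarrow> bool" where
  "nth_eve \<rho> i a \<longleftrightarrow> (\<exists>z. 0 < fst z \<and> n_atomic (Suc i) (\<rho> (fst z)) \<and> a \<in> atoms (\<rho> (fst z)) \<and>
     (i = 0 \<or> 0 < snd z \<and> n_atomic i (\<rho> (snd z)) \<and> a \<notin> atoms (\<rho> (snd z))))"

section \<open>Equivalence of the Eve conditions with \<open>coming_down\<close>\<close>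

text \<open>The atoms present at any time are an initial segment of the Eves, so their number tells
  which ones they are. Times between consecutive extinction times realise every positive number of
  atoms, and this singles out each Eve by its presence and absence.\<close>

lemma Eves_CDI_coming_down:
  assumes "Eves_CDI \<rho> e"
  shows "coming_down \<rho> \<and> (\<forall>i a. nth_eve \<rho> i a \<longleftrightarrow> a = e (Suc i))"
proof -
  let ?N = "\<lambda>t. card (atoms (\<rho> t))"
  have fa: "finitely_atomic (\<rho> t)" if "0 < t" for t using assms that unfolding Eves_CDI_def by blast
  have sub: "atoms (\<rho> (t + s)) \<subseteq> atoms (\<rho> t)" if "0 < t" "0 < s" for t s
    using assms that unfolding Eves_CDI_def by blast
  have cad: "cadlag_on {0<..} euclideanreal (\<lambda>t. real (?N t))"
    and jump: "\<And>t l. 0 < t \<Longrightarrow> ((\<lambda>s. real (?N s)) \<longlongrightarrow> l) (at_left t) \<Longrightarrow> real (?N t) - l \<in> {0, -1}"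
    and bij: "bij_betw e {1..} (\<Union>t\<in>{0<..}. atoms (\<rho> t))"
    and ext: "\<And>i j. 1 \<le> i \<Longrightarrow> i < j \<Longrightarrow> extinction_time \<rho> (e j) < extinction_time \<rho> (e i)"
    using assms unfolding Eves_CDI_def by blast+
  note dec = atoms_antimono[OF sub]
  have inj: "inj_on e {1..}" and im: "e ` {1..} = (\<Union>t\<in>{0<..}. atoms (\<rho> t))"
    using bij by (auto simp: bij_betw_def)
  have init: "atoms (\<rho> t) = e ` {1..?N t}" if t: "0 < t" for t
  proof -
    define J where "J = {j \<in> {1..}. e j \<in> atoms (\<rho> t)}"
    have "atoms (\<rho> t) \<subseteq> e ` {1..}" unfolding im using t by auto
    then have A: "atoms (\<rho> t) = e ` J" unfolding J_def by blast
    have injJ: "inj_on e J" by (rule inj_on_subset[OF inj]) (auto simp: J_def)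
    have "finite J" using finitely_atomic_finite[OF fa[OF t]] unfolding A finite_image_iff[OF injJ] .
    moreover have "i \<in> J" if "1 \<le> i" "i < j" "j \<in> J" for i j
    proof -
      have "ereal t \<le> extinction_time \<rho> (e j)" using that t by (intro le_extinction_time) (auto simp: J_def)
      also have "\<dots> < extinction_time \<rho> (e i)" using ext that by blast
      finally show ?thesis using less_extinction_time_iff[OF dec t] that by (auto simp: J_def)
    qed
    ultimately have "J = {1..card J}" by (intro initial_segment_eq) (auto simp: J_def)
    moreover have "card J = ?N t" unfolding A by (rule card_image[OF injJ, symmetric])
    ultimately show ?thesis using A by metis
  qed
  have fill: "\<exists>t. 0 < t \<and> n_atomic (Suc n) (\<rho> t)" for n
  proof -
    let ?d = "extinction_time \<rho>"
    have "?d (e (Suc (Suc n))) < ?d (e (Suc n))" by (rule ext) auto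
    then obtain t where t: "?d (e (Suc (Suc n))) < ereal t" "ereal t < ?d (e (Suc n))"
      using ereal_dense2 by blast
    have "e (Suc (Suc n)) \<in> (\<Union>t\<in>{0<..}. atoms (\<rho> t))" unfolding im[symmetric] by auto
    then obtain s where s: "0 < s" "e (Suc (Suc n)) \<in> atoms (\<rho> s)" by auto
    then have "ereal s \<le> ?d (e (Suc (Suc n)))" by (rule le_extinction_time)
    then have "ereal s < ereal t" using t(1) by (rule le_less_trans)
    then have t0: "0 < t" using s(1) by simp
    have "e (Suc n) \<in> atoms (\<rho> t)" by (rule less_extinction_time_iff[OF dec t0 t(2)])
    then have "e (Suc n) \<in> e ` {1..?N t}" unfolding init[OF t0, symmetric] .
    then obtain j where j: "j \<in> {1..?N t}" "e (Suc n) = e j" by blast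
    then have "j = Suc n" using inj_onD[OF inj, of "Suc n" j] by auto
    then have "Suc n \<le> ?N t" using j by simp
    moreover have "\<not> Suc (Suc n) \<le> ?N t"
    proof
      assume "Suc (Suc n) \<le> ?N t"
      then have "e (Suc (Suc n)) \<in> e ` {1..?N t}" by (intro imageI) simp
      then have "e (Suc (Suc n)) \<in> atoms (\<rho> t)" unfolding init[OF t0, symmetric] .
      then have "ereal t \<le> ?d (e (Suc (Suc n)))" by (rule le_extinction_time[OF t0])
      then show False using t(1) by simp
    qed
    ultimately have "?N t = Suc n" by simp
    then show ?thesis using fa[OF t0] t0 unfolding n_atomic_def by blast
  qed
  have segm: "atoms (\<rho> t) = e ` {1..n}" if "0 < t" "n_atomic n (\<rho> t)" for n t
  proof -
    have "?N t = n" using that(2) unfolding n_atomic_def by blast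
    then show ?thesis using init[OF that(1)] by metis
  qed
  have right: "\<exists>n k. n_atomic n (\<rho> t) \<and> n_atomic n (\<rho> (t + 1 / real (Suc k)))" if t: "0 < t" for t
  proof -
    have "{0<..} \<inter> {t<..} = {t<..}" using t by auto
    then have "((\<lambda>s. real (?N s)) \<longlongrightarrow> real (?N t)) (at_right t)"
      using cad t unfolding cadlag_on_def limitin_canonical_iff by (metis greaterThan_iff)
    then have "eventually (\<lambda>s. ?N s = ?N t) (at_right t)" by (rule eventually_eq_of_nat_limit) simp
    then obtain b where b: "t < b" "\<And>s. t < s \<Longrightarrow> s < b \<Longrightarrow> ?N s = ?N t"
      unfolding eventually_at_right_field by blast
    obtain k where k: "inverse (real (Suc k)) < b - t" using reals_Archimedean[of "b - t"] b(1) by auto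
    have "?N (t + 1 / real (Suc k)) = ?N t" by (rule b(2)) (use k in \<open>simp_all add: inverse_eq_divide\<close>)
    moreover have "0 < t + 1 / real (Suc k)" using t by (simp add: add_pos_nonneg)
    ultimately show ?thesis using fa[OF t] fa[of "t + 1 / real (Suc k)"] unfolding n_atomic_def by metis
  qed
  have left: "\<exists>n k. 1 / real (Suc k) < t \<and> n_atomic n (\<rho> t) \<and>
      (n_atomic n (\<rho> (t - 1 / real (Suc k))) \<or> n_atomic (Suc n) (\<rho> (t - 1 / real (Suc k))))"
    if t: "0 < t" for t
  proof -
    obtain l where l: "((\<lambda>s. real (?N s)) \<longlongrightarrow> l) (at_left t)"
      using cad t at_within_pos_lessThan[OF t] unfolding cadlag_on_def limitin_canonical_iff by (metis greaterThan_iff)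
    have "real (?N t) - l \<in> {0, -1}" by (rule jump[OF t l])
    \<comment> \<open>The jump condition makes the left limit a natural number, so the count is
      constant just before \<open>t\<close>.\<close>
    then have "l = real (?N t) \<or> l = real (Suc (?N t))" by auto
    then obtain m where m: "l = real m" "m = ?N t \<or> m = Suc (?N t)" by blast
    have "eventually (\<lambda>s. ?N s = m) (at_left t)" by (rule eventually_eq_of_nat_limit[OF l m(1)])
    then obtain b where b: "b < t" "\<And>s. b < s \<Longrightarrow> s < t \<Longrightarrow> ?N s = m"
      unfolding eventually_at_left_field by blast
    obtain k where k: "inverse (real (Suc k)) < min t (t - b)"
      using reals_Archimedean[of "min t (t - b)"] b(1) t by auto
    have "?N (t - 1 / real (Suc k)) = m" by (rule b(2)) (use k in \<open>simp_all add: inverse_eq_divide\<close>)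
    moreover have k': "1 / real (Suc k) < t" using k by (simp add: inverse_eq_divide)
    moreover have "finitely_atomic (\<rho> (t - 1 / real (Suc k)))" using k' by (intro fa) simp
    ultimately show ?thesis using fa[OF t] m(2) unfolding n_atomic_def by metis
  qed
  have "coming_down \<rho>"
    unfolding coming_down_def
  proof (intro conjI allI impI)
    show "\<exists>n. n_atomic n (\<rho> t)" if "0 < t" for t using fa[OF that] unfolding n_atomic_def by blast
    show "snd (snd z) \<in> atoms (\<rho> (fst z))"
      if "0 < fst z \<and> 0 < fst (snd z) \<and> snd (snd z) \<in> atoms (\<rho> (fst z + fst (snd z)))" for z
      using that sub by blast
  qed (fact right left fill)+
  moreover have "nth_eve \<rho> i a \<longleftrightarrow> a = e (Suc i)" for i a
  proof
    assume "nth_eve \<rho> i a"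
    then obtain t s where ts: "0 < t" "n_atomic (Suc i) (\<rho> t)" "a \<in> atoms (\<rho> t)"
      "i = 0 \<or> 0 < s \<and> n_atomic i (\<rho> s) \<and> a \<notin> atoms (\<rho> s)"
      unfolding nth_eve_def by auto
    have "a \<notin> e ` {1..i}" using ts(4) segm[of s i] by auto
    moreover have "a \<in> e ` {1..Suc i}" using ts(3) segm[OF ts(1,2)] by simp
    ultimately show "a = e (Suc i)" by (auto simp: le_Suc_eq)
  next
    assume a: "a = e (Suc i)"
    obtain t where t: "0 < t" "n_atomic (Suc i) (\<rho> t)" using fill by blast
    have "a \<in> atoms (\<rho> t)" unfolding segm[OF t] a by (intro imageI) simp
    moreover have "\<exists>s. i = 0 \<or> 0 < s \<and> n_atomic i (\<rho> s) \<and> a \<notin> atoms (\<rho> s)"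
    proof (cases i)
      case (Suc j)
      obtain s where s: "0 < s" "n_atomic i (\<rho> s)" using fill[of j] Suc by blast
      have "a \<notin> e ` {1..i}"
      proof
        assume "a \<in> e ` {1..i}"
        then obtain j where "j \<in> {1..i}" "e (Suc i) = e j" using a by auto
        then show False using inj_onD[OF inj, of "Suc i" j] by auto
      qed
      then show ?thesis using s segm[OF s] by metis
    qed simp
    ultimately show "nth_eve \<rho> i a" unfolding nth_eve_def using t by (metis fst_conv snd_conv)
  qed
  ultimately show ?thesis by blast
qed

text \<open>By monotonicity the atom set at a time depends on its size only, so the atom sets form a
  chain that grows by one element per step; the added elements are the Eves. Two Eves cannot die
  together: right-continuity makes both absent at a common finite extinction time while both are
  present before it, which would be a jump by at least \<open>2\<close>.\<close>

lemma coming_down_Eves_CDI: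
  assumes "coming_down \<rho>"
  shows "\<exists>e. e \<in> {1..} \<rightarrow>\<^sub>E {0..1} \<and> Eves_CDI \<rho> e"
proof -
  let ?N = "\<lambda>t. card (atoms (\<rho> t))" and ?d = "extinction_time \<rho>"
  note c = assms[unfolded coming_down_def]
  note c1 = c[THEN conjunct1, rule_format]
    and c2 = c[THEN conjunct2, THEN conjunct1, rule_format]
    and c3 = c[THEN conjunct2, THEN conjunct2, THEN conjunct1, rule_format]
    and c4 = c[THEN conjunct2, THEN conjunct2, THEN conjunct2, THEN conjunct1, rule_format]
    and c5 = c[THEN conjunct2, THEN conjunct2, THEN conjunct2, THEN conjunct2, rule_format]
  have fa: "finitely_atomic (\<rho> t)" if "0 < t" for t
    using c1[OF that] unfolding n_atomic_def by blast
  have sub: "atoms (\<rho> (t + s)) \<subseteq> atoms (\<rho> t)" if "0 < t" "0 < s" for t s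
  proof
    fix a assume "a \<in> atoms (\<rho> (t + s))"
    then show "a \<in> atoms (\<rho> t)" using c2[of "(t, s, a)"] that by simp
  qed
  have right: "\<exists>k. ?N (t + 1 / real (Suc k)) = ?N t" if "0 < t" for t
    using c3[OF that] unfolding n_atomic_def by (elim exE conjE) (metis)
  have left: "\<exists>k. 1 / real (Suc k) < t \<and> ?N (t - 1 / real (Suc k)) \<le> Suc (?N t)" if t: "0 < t" for t
  proof -
    obtain n k where nk: "1 / real (Suc k) < t" "n_atomic n (\<rho> t)"
      "n_atomic n (\<rho> (t - 1 / real (Suc k))) \<or> n_atomic (Suc n) (\<rho> (t - 1 / real (Suc k)))"
      using c4[OF t] by (elim exE conjE)
    have "?N (t - 1 / real (Suc k)) \<le> Suc (?N t)" using nk(2,3) unfolding n_atomic_def by (elim disjE conjE) simp_all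
    then show ?thesis using nk(1) by blast
  qed
  have "\<forall>n. \<exists>t. 0 < t \<and> ?N t = Suc n"
    using c5 unfolding n_atomic_def by blast
  from choice[OF this] obtain T where T: "\<And>n. 0 < T n" "\<And>n. ?N (T n) = Suc n" by blast
  note dec = atoms_antimono[OF sub]
  note fin = finitely_atomic_finite[OF fa]
  have Ndec: "?N t \<le> ?N s" if "0 < s" "s \<le> t" for s t
    using that by (intro card_mono fin dec)
  \<comment> \<open>Atom sets at two times are comparable, and equal if their sizes are, so sizes
    alone decide inclusion.\<close>
  have nested: "atoms (\<rho> s) \<subseteq> atoms (\<rho> t)" if "0 < s" "0 < t" "?N s \<le> ?N t" for s t
  proof (cases "t \<le> s")
    case True
    then show ?thesis using dec that by blast
  next
    case False
    then have "atoms (\<rho> t) \<subseteq> atoms (\<rho> s)" using that by (intro dec) auto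
    then have "atoms (\<rho> t) = atoms (\<rho> s)" using that fin by (intro card_seteq) auto
    then show ?thesis by simp
  qed
  \<comment> \<open>The atom set of size \<open>n\<close>. The shift arises because there are
    \<open>Suc m\<close> atoms at time \<open>T m\<close>; the empty set is put at the bottom of the
    chain.\<close>
  define B where "B n = (case n of 0 \<Rightarrow> {} | Suc m \<Rightarrow> atoms (\<rho> (T m)))" for n
  have cB: "card (B n) = n" "finite (B n)" for n
    using T fin by (auto simp: B_def split: nat.split)
  have B_mono: "B m \<subseteq> B n" if le: "m \<le> n" for m n
  proof (cases m)
    case (Suc m')
    then obtain n' where "n = Suc n'" using le by (cases n) auto
    then show ?thesis using nested[of "T m'" "T n'"] T le Suc by (simp add: B_def)
  qed (simp add: B_def)
  have atB: "atoms (\<rho> t) = B (?N t)" if t: "0 < t" for t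
  proof (cases "?N t")
    case 0
    then have "atoms (\<rho> t) = {}" using fin[OF t] by simp
    then show ?thesis by (simp add: B_def)
  next
    case (Suc m)
    then have "?N t = ?N (T m)" using T by simp
    then have "atoms (\<rho> t) = atoms (\<rho> (T m))" using nested[OF t T(1)[of m]] nested[OF T(1)[of m] t] by auto
    then show ?thesis unfolding Suc by (simp add: B_def)
  qed
  have "\<forall>n. \<exists>a. B (Suc n) - B n = {a}"
  proof
    fix n
    have "card (B (Suc n) - B n) = 1" using cB B_mono[of n "Suc n"] by (simp add: card_Diff_subset)
    then show "\<exists>a. B (Suc n) - B n = {a}" by (rule card_1_singletonE) blast
  qed
  from choice[OF this] obtain g where g: "\<And>n. B (Suc n) - B n = {g n}" by blast
  have g1: "g n \<in> B (Suc n)" "g n \<notin> B n" for n using g[of n] by auto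
  have Bg: "B n = g ` {..<n}" for n
  proof (induction n)
    case (Suc n)
    have "B (Suc n) = insert (g n) (B n)" using g[of n] B_mono[of n "Suc n"] by auto
    then show ?case unfolding Suc by (simp add: lessThan_Suc)
  qed (simp add: B_def)
  have g_ne: "g m \<noteq> g n" if "m < n" for m n
    using g1(1)[of m] g1(2)[of n] B_mono[of "Suc m" n] that by auto
  have inj_g: "inj g"
  proof (rule injI)
    fix m n assume "g m = g n" then show "m = n" using g_ne[of m n] g_ne[of n m] by (metis nat_neq_iff)
  qed
  have Un: "(\<Union>t\<in>{0<..}. atoms (\<rho> t)) = range g"
  proof (intro equalityI subsetI)
    fix a assume "a \<in> (\<Union>t\<in>{0<..}. atoms (\<rho> t))"
    then obtain t where "0 < t" "a \<in> atoms (\<rho> t)" by auto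
    then have "a \<in> B (?N t)" using atB[symmetric, of t] by simp
    then show "a \<in> range g" unfolding Bg by blast
  next
    fix a assume "a \<in> range g"
    then obtain n where "a = g n" by blast
    then have "a \<in> atoms (\<rho> (T n))" using g1(1)[of n] by (simp add: B_def)
    then show "a \<in> (\<Union>t\<in>{0<..}. atoms (\<rho> t))" using T(1)[of n] by blast
  qed
  define e where "e = (\<lambda>i\<in>{1..}. g (i - 1))"
  have "(\<lambda>i. i - 1) ` {1..} = (UNIV :: nat set)"
  proof (intro equalityI subsetI)
    fix n :: nat show "n \<in> (\<lambda>i. i - 1) ` {1..}" by (rule image_eqI[of _ _ "Suc n"]) auto
  qed simp
  then have im: "e ` {1..} = range g" unfolding e_def by (metis image_image image_restrict_eq)
  have bij: "bij_betw e {1..} (\<Union>t\<in>{0<..}. atoms (\<rho> t))"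
    unfolding bij_betw_def Un
  proof
    show "inj_on e {1..}"
    proof (rule inj_onI)
      fix i j :: nat assume "i \<in> {1..}" "j \<in> {1..}" "e i = e j"
      then show "i = j" using injD[OF inj_g, of "i - 1" "j - 1"] by (simp add: e_def)
    qed
  qed (fact im)
  have ext: "?d (g n) < ?d (g m)" if mn: "m < n" for m n
  proof -
    have imp: "g m \<in> atoms (\<rho> t)" if "0 < t" "g n \<in> atoms (\<rho> t)" for t
    proof -
      have "g n \<in> B (?N t)" using that(2) unfolding atB[OF that(1), symmetric] .
      then have "\<not> ?N t \<le> n" using g1(2)[of n] B_mono[of "?N t" n] by blast
      then have "B (Suc m) \<subseteq> B (?N t)" using mn by (intro B_mono) simp
      then show ?thesis using g1(1)[of m] unfolding atB[OF that(1), symmetric] by blast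
    qed
    have le: "?d (g n) \<le> ?d (g m)"
      unfolding extinction_time_def by (rule Sup_subset_mono) (use imp in blast)
    have "?d (g n) \<noteq> ?d (g m)"
    proof
      assume eq: "?d (g n) = ?d (g m)"
      have "g n \<in> atoms (\<rho> (T n))" using g1(1)[of n] by (simp add: B_def)
      then have s0: "ereal (T n) \<le> ?d (g n)" by (rule le_extinction_time[OF T(1)])
      show False
      proof (cases "?d (g n)")
        \<comment> \<open>With an infinite extinction time \<open>g n\<close> would still be among
          the \<open>Suc m\<close> atoms at time \<open>T m\<close>, although
          \<open>n > m\<close>.\<close>
        case PInf
        then have "g n \<in> atoms (\<rho> (T m))" by (intro less_extinction_time_iff[OF dec T(1)]) simp_all
        then have "g n \<in> B (Suc m)" by (simp add: B_def)
        then show False using g1(2)[of n] B_mono[of "Suc m" n] mn by auto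
      next
        case MInf then show False using s0 by simp
      next
        case (real r)
        then have r: "0 < r" using s0 T(1)[of n] by simp
        obtain k where k: "?N (r + 1 / real (Suc k)) = ?N r" using right[OF r] by blast
        have r': "0 < r + 1 / real (Suc k)" using r by (simp add: add_pos_nonneg)
        have eqr: "atoms (\<rho> r) \<subseteq> atoms (\<rho> (r + 1 / real (Suc k)))" using nested[OF r r'] k by simp
        \<comment> \<open>The atoms at \<open>r\<close> are still all there shortly after
          \<open>r\<close>, so an atom present at \<open>r\<close> dies strictly later.\<close>
        have out: "a \<notin> atoms (\<rho> r)" if "?d a = ereal r" for a
        proof
          assume "a \<in> atoms (\<rho> r)"
          then have "a \<in> atoms (\<rho> (r + 1 / real (Suc k)))" using eqr by blast
          then have "ereal (r + 1 / real (Suc k)) \<le> ereal r" using le_extinction_time[OF r'] that by metis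
          then show False by simp
        qed
        obtain k' where k': "1 / real (Suc k') < r" "?N (r - 1 / real (Suc k')) \<le> Suc (?N r)"
          using left[OF r] by blast
        define u where "u = r - 1 / real (Suc k')"
        have u: "0 < u" "u < r" using k'(1) by (simp_all add: u_def)
        \<comment> \<open>Both Eves and all atoms of time \<open>r\<close> are present at
          \<open>u\<close>: at least two more atoms than at \<open>r\<close>, against the choice of
          \<open>u\<close>.\<close>
        have "g n \<in> atoms (\<rho> u)" "g m \<in> atoms (\<rho> u)"
          using u real eq by (auto intro!: less_extinction_time_iff[OF dec u(1)])
        moreover have "atoms (\<rho> r) \<subseteq> atoms (\<rho> u)" using u by (intro dec) auto
        ultimately have "insert (g n) (insert (g m) (atoms (\<rho> r))) \<subseteq> atoms (\<rho> u)" by blast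
        then have "card (insert (g n) (insert (g m) (atoms (\<rho> r)))) \<le> ?N u"
          using fin[OF u(1)] by (intro card_mono)
        moreover have "card (insert (g n) (insert (g m) (atoms (\<rho> r)))) = Suc (Suc (?N r))"
          using out[of "g n"] out[of "g m"] real eq fin[OF r] g_ne[OF mn] by auto
        ultimately show False using k'(2) unfolding u_def[symmetric] by simp
      qed
    qed
    then show ?thesis using le by simp
  qed
  have lim_right: "((\<lambda>s. real (?N s)) \<longlongrightarrow> real (?N t)) (at_right t)" if t: "0 < t" for t
  proof -
    obtain k where k: "?N (t + 1 / real (Suc k)) = ?N t" using right[OF t] by blast
    have "?N s = ?N t" if "t < s" "s < t + 1 / real (Suc k)" for s
      using Ndec[of t s] Ndec[of s "t + 1 / real (Suc k)"] that k t by simp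
    moreover have "t < t + 1 / real (Suc k)" by simp
    ultimately have "eventually (\<lambda>s. ?N s = ?N t) (at_right t)"
      unfolding eventually_at_right_field by blast
    then show ?thesis by (intro tendsto_eventually) (auto elim: eventually_mono)
  qed
  have lim_left: "\<exists>m. m \<in> {?N t, Suc (?N t)} \<and> ((\<lambda>s. real (?N s)) \<longlongrightarrow> real m) (at_left t)" if t: "0 < t" for t
  proof -
    obtain k where k: "1 / real (Suc k) < t" "?N (t - 1 / real (Suc k)) \<le> Suc (?N t)" using left[OF t] by blast
    define u where "u = t - 1 / real (Suc k)"
    have u: "0 < u" "u < t" using k(1) by (simp_all add: u_def)
    have N: "?N t \<le> ?N s \<and> ?N s \<le> Suc (?N t)" if "u < s" "s < t" for s
      using Ndec[of s t] Ndec[of u s] that u k(2) unfolding u_def[symmetric] by simp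
    have "\<exists>m v. m \<in> {?N t, Suc (?N t)} \<and> v < t \<and> (\<forall>s. v < s \<and> s < t \<longrightarrow> ?N s = m)"
    \<comment> \<open>Once the decreasing count has reached \<open>?N t\<close> it stays there until
      \<open>t\<close>; otherwise it equals \<open>Suc (?N t)\<close> on the whole interval.\<close>
    proof (cases "\<exists>s. u < s \<and> s < t \<and> ?N s = ?N t")
      case True
      then obtain s0 where s0: "u < s0" "s0 < t" "?N s0 = ?N t" by blast
      have "?N s = ?N t" if "s0 < s" "s < t" for s
        using Ndec[of s0 s] N[of s] that s0 u by simp
      then show ?thesis using s0(2) by (intro exI[of _ "?N t"] exI[of _ s0]) auto
    next
      case False
      have "?N s = Suc (?N t)" if "u < s" "s < t" for s
      proof -
        have "?N s \<noteq> ?N t" using False that by blast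
        then show ?thesis using N[OF that] by simp
      qed
      then show ?thesis using u(2) by (intro exI[of _ "Suc (?N t)"] exI[of _ u]) auto
    qed
    then obtain m v where m: "m \<in> {?N t, Suc (?N t)}" "v < t" "\<And>s. v < s \<Longrightarrow> s < t \<Longrightarrow> ?N s = m" by blast
    then have "eventually (\<lambda>s. ?N s = m) (at_left t)" unfolding eventually_at_left_field by blast
    then have "((\<lambda>s. real (?N s)) \<longlongrightarrow> real m) (at_left t)"
      by (intro tendsto_eventually) (auto elim: eventually_mono)
    then show ?thesis using m(1) by blast
  qed
  have "Eves_CDI \<rho> e"
    unfolding Eves_CDI_def
  proof (intro conjI allI impI)
    show "cadlag_on {0<..} euclideanreal (\<lambda>t. real (?N t))"
      unfolding cadlag_on_def limitin_canonical_iff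
    proof (intro ballI conjI)
      fix t :: real assume "t \<in> {0<..}"
      then have t: "0 < t" by simp
      have "{0<..} \<inter> {t<..} = {t<..}" using t by auto
      then have eq: "at t within {0<..} \<inter> {t<..} = at_right t" "at t within {0<..} \<inter> {..<t} = at_left t"
        using at_within_pos_lessThan[OF t] by simp_all
      show "((\<lambda>s. real (?N s)) \<longlongrightarrow> real (?N t)) (at t within {0<..} \<inter> {t<..})"
        unfolding eq by (rule lim_right[OF t])
      show "\<exists>l. ((\<lambda>s. real (?N s)) \<longlongrightarrow> l) (at t within {0<..} \<inter> {..<t})"
        unfolding eq using lim_left[OF t] by blast
    qed
    show "real (?N t) - l \<in> {0, -1}" if t: "0 < t" and l: "((\<lambda>s. real (?N s)) \<longlongrightarrow> l) (at_left t)" for t l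
    proof -
      obtain m where m: "m \<in> {?N t, Suc (?N t)}" "((\<lambda>s. real (?N s)) \<longlongrightarrow> real m) (at_left t)"
        using lim_left[OF t] by blast
      have "l = real m" by (rule tendsto_unique[OF _ l m(2)]) simp
      then show ?thesis using m(1) by auto
    qed
    show "extinction_time \<rho> (e j) < extinction_time \<rho> (e i)" if "1 \<le> i \<and> i < j" for i j
    proof -
      have "?d (g (j - 1)) < ?d (g (i - 1))" by (rule ext) (use that in linarith)
      then show ?thesis using that by (simp add: e_def)
    qed
  qed (use fa sub bij in auto)
  moreover have "e \<in> {1..} \<rightarrow>\<^sub>E {0..1}"
  proof -
    have "g n \<in> {0..1}" for n using g1(1)[of n] by (simp add: B_def atoms_def)
    then show ?thesis unfolding e_def by (intro restrict_PiE_iff[THEN iffD2]) blast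
  qed
  ultimately show ?thesis by blast
qed

section \<open>Measurability of the Eves in regime CDI\<close>

context skorohod_measure
begin

text \<open>The guard \<open>0 < t z\<close> hides the truncation \<open>max 0\<close>, which is
  there to evaluate the path at nonnegative times only.\<close>

lemma n_atomic_path_measurable:
  assumes R: "R \<in> N \<rightarrow>\<^sub>M Q" and t [measurable]: "t \<in> borel_measurable N"
  shows "Measurable.pred N (\<lambda>z. 0 < t z \<and> n_atomic n (R z (t z)))"
proof -
  have [measurable]: "Measurable.pred N (\<lambda>z. n_atomic n (R z (max 0 (t z))))"
    by (rule n_atomic_measurable[OF measurable_path[OF R]]) simp_all
  have "Measurable.pred N (\<lambda>z. 0 < t z \<and> n_atomic n (R z (max 0 (t z))))" by measurable
  also have "(\<lambda>z. 0 < t z \<and> n_atomic n (R z (max 0 (t z)))) = (\<lambda>z. 0 < t z \<and> n_atomic n (R z (t z)))"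
    by (auto simp: fun_eq_iff max_def)
  finally show ?thesis .
qed

lemma atom_path_measurable:
  assumes R: "R \<in> N \<rightarrow>\<^sub>M Q" and t [measurable]: "t \<in> borel_measurable N" and a: "a \<in> borel_measurable N"
  shows "Measurable.pred N (\<lambda>z. 0 < t z \<and> a z \<in> atoms (R z (t z)))"
proof -
  have [measurable]: "Measurable.pred N (\<lambda>z. a z \<in> atoms (R z (max 0 (t z))))"
    by (rule atom_measurable[OF measurable_path[OF R] a]) simp_all
  have "Measurable.pred N (\<lambda>z. 0 < t z \<and> a z \<in> atoms (R z (max 0 (t z))))" by measurable
  also have "(\<lambda>z. 0 < t z \<and> a z \<in> atoms (R z (max 0 (t z)))) = (\<lambda>z. 0 < t z \<and> a z \<in> atoms (R z (t z)))"
    by (auto simp: fun_eq_iff max_def)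
  finally show ?thesis .
qed

text \<open>In \<open>measurable_projection\<close> a quantified tuple carries the Borel sigma-field
  of its product type, not a product sigma-field; its coordinates are measurable by
  continuity.\<close>

lemma borel_measurable_fst_snd:
  "fst \<in> borel_measurable (borel :: ('x::second_countable_topology \<times> 'y::second_countable_topology) measure)"
  "snd \<in> borel_measurable (borel :: ('x::second_countable_topology \<times> 'y::second_countable_topology) measure)"
  by (intro borel_measurable_continuous_onI continuous_intros)+

text \<open>Each evaluation of the path is given its own positivity guard, to match
  \<open>n_atomic_path_measurable\<close> and \<open>atom_path_measurable\<close>; the guards follow
  from the conditions on the times, so the guarded form equals \<open>coming_down\<close>. The three
  reals of the monotonicity clause form one tuple, and a single projection handles them.\<close>

lemma coming_down_measurable: "Measurable.pred Q coming_down"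
proof -
  let ?N = "Q \<Otimes>\<^sub>M (borel :: real measure)" and ?N3 = "Q \<Otimes>\<^sub>M (borel :: (real \<times> real \<times> real) measure)"
  note [measurable] = borel_measurable_fst_snd
  note na [measurable] = n_atomic_path_measurable[OF measurable_fst]
  note at [measurable] = atom_path_measurable[OF measurable_fst]
  note all = measurable_projection_all[OF finite_measure_axioms] and ex = measurable_projection[OF finite_measure_axioms]
  have 1: "Measurable.pred Q (\<lambda>\<rho>. \<forall>t. 0 < t \<longrightarrow> (\<exists>n. 0 < t \<and> n_atomic n (\<rho> t)))"
    by (rule all, unfold split_beta') measurable
  have 2: "Measurable.pred Q (\<lambda>\<rho>. \<forall>z. 0 < fst z \<and> 0 < fst (snd z) \<and>
      (0 < fst z + fst (snd z) \<and> snd (snd z) \<in> atoms (\<rho> (fst z + fst (snd z)))) \<longrightarrow>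
      (0 < fst z \<and> snd (snd z) \<in> atoms (\<rho> (fst z))))"
    by (rule all, unfold split_beta') measurable
  have 3: "Measurable.pred Q (\<lambda>\<rho>. \<forall>t. 0 < t \<longrightarrow> (\<exists>n k. (0 < t \<and> n_atomic n (\<rho> t)) \<and>
      (0 < t + 1 / real (Suc k) \<and> n_atomic n (\<rho> (t + 1 / real (Suc k))))))"
    by (rule all, unfold split_beta') measurable
  have 4: "Measurable.pred Q (\<lambda>\<rho>. \<forall>t. 0 < t \<longrightarrow> (\<exists>n k. 1 / real (Suc k) < t \<and> (0 < t \<and> n_atomic n (\<rho> t)) \<and>
      ((0 < t - 1 / real (Suc k) \<and> n_atomic n (\<rho> (t - 1 / real (Suc k)))) \<or>
       (0 < t - 1 / real (Suc k) \<and> n_atomic (Suc n) (\<rho> (t - 1 / real (Suc k)))))))"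
    by (rule all, unfold split_beta') measurable
  have 5: "Measurable.pred Q (\<lambda>\<rho>. \<forall>n. \<exists>t. 0 < t \<and> n_atomic (Suc n) (\<rho> t))"
    by (rule pred_intros_countable, rule ex, unfold split_beta') measurable
  have "Measurable.pred Q (\<lambda>\<rho>.
      (\<forall>t. 0 < t \<longrightarrow> (\<exists>n. 0 < t \<and> n_atomic n (\<rho> t))) \<and>
      (\<forall>z. 0 < fst z \<and> 0 < fst (snd z) \<and>
        (0 < fst z + fst (snd z) \<and> snd (snd z) \<in> atoms (\<rho> (fst z + fst (snd z)))) \<longrightarrow>
        (0 < fst z \<and> snd (snd z) \<in> atoms (\<rho> (fst z)))) \<and>
      (\<forall>t. 0 < t \<longrightarrow> (\<exists>n k. (0 < t \<and> n_atomic n (\<rho> t)) \<and>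
        (0 < t + 1 / real (Suc k) \<and> n_atomic n (\<rho> (t + 1 / real (Suc k)))))) \<and>
      (\<forall>t. 0 < t \<longrightarrow> (\<exists>n k. 1 / real (Suc k) < t \<and> (0 < t \<and> n_atomic n (\<rho> t)) \<and>
        ((0 < t - 1 / real (Suc k) \<and> n_atomic n (\<rho> (t - 1 / real (Suc k)))) \<or>
         (0 < t - 1 / real (Suc k) \<and> n_atomic (Suc n) (\<rho> (t - 1 / real (Suc k))))))) \<and>
      (\<forall>n. \<exists>t. 0 < t \<and> n_atomic (Suc n) (\<rho> t)))"
    by (intro pred_intros_logic(3) 1 2 3 4 5)
  also have "(\<lambda>\<rho>. (\<forall>t. 0 < t \<longrightarrow> (\<exists>n. 0 < t \<and> n_atomic n (\<rho> t))) \<and>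
      (\<forall>z. 0 < fst z \<and> 0 < fst (snd z) \<and>
        (0 < fst z + fst (snd z) \<and> snd (snd z) \<in> atoms (\<rho> (fst z + fst (snd z)))) \<longrightarrow>
        (0 < fst z \<and> snd (snd z) \<in> atoms (\<rho> (fst z)))) \<and>
      (\<forall>t. 0 < t \<longrightarrow> (\<exists>n k. (0 < t \<and> n_atomic n (\<rho> t)) \<and>
        (0 < t + 1 / real (Suc k) \<and> n_atomic n (\<rho> (t + 1 / real (Suc k)))))) \<and>
      (\<forall>t. 0 < t \<longrightarrow> (\<exists>n k. 1 / real (Suc k) < t \<and> (0 < t \<and> n_atomic n (\<rho> t)) \<and>
        ((0 < t - 1 / real (Suc k) \<and> n_atomic n (\<rho> (t - 1 / real (Suc k)))) \<or>
         (0 < t - 1 / real (Suc k) \<and> n_atomic (Suc n) (\<rho> (t - 1 / real (Suc k))))))) \<and>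
      (\<forall>n. \<exists>t. 0 < t \<and> n_atomic (Suc n) (\<rho> t))) = coming_down"
    unfolding coming_down_def[abs_def]
    by (intro ext conj_cong arg_cong[where f = All] imp_cong refl arg_cong[where f = Ex])
       (auto simp: add_pos_nonneg)
  finally show ?thesis .
qed

text \<open>The position, the time of presence and the time of absence are quantified jointly as
  \<open>w\<close>, so one projection is enough.\<close>

lemma nth_eve_measurable:
  assumes [measurable]: "B \<in> sets borel"
  shows "Measurable.pred Q (\<lambda>\<rho>. \<exists>a. a \<in> B \<and> nth_eve \<rho> i a)"
proof -
  note [measurable] = borel_measurable_fst_snd
    n_atomic_path_measurable[OF measurable_fst] atom_path_measurable[OF measurable_fst]
  have "Measurable.pred Q (\<lambda>\<rho>. \<exists>w. fst w \<in> B \<and> (0 < fst (snd w) \<and> n_atomic (Suc i) (\<rho> (fst (snd w)))) \<and>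
      (0 < fst (snd w) \<and> fst w \<in> atoms (\<rho> (fst (snd w)))) \<and>
      (i = 0 \<or> (0 < snd (snd w) \<and> n_atomic i (\<rho> (snd (snd w)))) \<and>
         \<not> (0 < snd (snd w) \<and> fst w \<in> atoms (\<rho> (snd (snd w))))))"
    by (rule measurable_projection[OF finite_measure_axioms], unfold split_beta') measurable
  also have "(\<lambda>\<rho>. \<exists>w. fst w \<in> B \<and> (0 < fst (snd w) \<and> n_atomic (Suc i) (\<rho> (fst (snd w)))) \<and>
      (0 < fst (snd w) \<and> fst w \<in> atoms (\<rho> (fst (snd w)))) \<and>
      (i = 0 \<or> (0 < snd (snd w) \<and> n_atomic i (\<rho> (snd (snd w)))) \<and>
         \<not> (0 < snd (snd w) \<and> fst w \<in> atoms (\<rho> (snd (snd w))))))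
      = (\<lambda>\<rho>. \<exists>a. a \<in> B \<and> nth_eve \<rho> i a)"
    unfolding nth_eve_def by (auto simp: fun_eq_iff)
  finally show ?thesis .
qed

lemma admits_Eves_measurable: "{\<rho> \<in> skorohod_space. admits_Eves \<Lambda> \<rho>} \<in> sets Q"
proof (cases "CDI \<Lambda>")
  case True
  have "{\<rho> \<in> skorohod_space. admits_Eves \<Lambda> \<rho>} = {\<rho> \<in> space Q. coming_down \<rho>}"
    unfolding space_Q admits_Eves_def is_Eves_def
    using Eves_CDI_coming_down coming_down_Eves_CDI True by auto
  then show ?thesis using coming_down_measurable by (simp add: pred_def)
qed (rule admits_Eves_nonCDI_measurable)

lemma Eves_measurable:
  "Eves \<Lambda> \<in> restrict_space Q {\<rho> \<in> skorohod_space. admits_Eves \<Lambda> \<rho>} \<rightarrow>\<^sub>M PiM {1..} (\<lambda>_. unit_borel)"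
proof -
  let ?O = "{\<rho> \<in> skorohod_space. admits_Eves \<Lambda> \<rho>}"
  let ?R = "restrict_space Q ?O"
  have space_R: "space ?R = ?O" by (auto simp: space_restrict_space space_Q)
  have O: "?O \<inter> space Q \<in> sets Q" using admits_Eves_measurable by (simp add: space_Q Int_absorb2)
  have E: "is_Eves \<Lambda> \<rho> (Eves \<Lambda> \<rho>)" if "\<rho> \<in> ?O" for \<rho>
    using that Eves_eq[of \<rho> \<Lambda>] by (auto simp: admits_Eves_def)
  have range: "Eves \<Lambda> \<rho> \<in> {1..} \<rightarrow>\<^sub>E {0..1}" if "\<rho> \<in> ?O" for \<rho>
    using E[OF that] by (simp add: is_Eves_def)
  have borel: "(\<lambda>\<rho>. Eves \<Lambda> \<rho> i) \<in> borel_measurable ?R" if i: "1 \<le> i" for i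
  proof (cases "CDI \<Lambda>")
    case False
    have "eve (i - 1) \<in> borel_measurable ?R"
      by (rule measurable_restrict_space1[OF eve_measurable])
    also have "?this \<longleftrightarrow> ?thesis"
      by (rule measurable_cong) (use Eves_nonCDI_eq[OF False] i space_R in auto)
    finally show ?thesis .
  next
    case True
    show ?thesis
    proof (rule measurableI)
      fix B :: "real set" assume B: "B \<in> sets borel"
      have "{\<rho> \<in> space Q. \<exists>a. a \<in> B \<and> nth_eve \<rho> (i - 1) a} \<in> sets Q"
        using nth_eve_measurable[OF B] by (simp add: pred_def)
      \<comment> \<open>On \<open>?O\<close> the only \<open>a\<close> with
        \<open>nth_eve \<rho> (i - 1) a\<close> is the \<open>i\<close>-th Eve; the description
        operator thereby disappears from the preimage.\<close>
      moreover have "(\<exists>a. a \<in> B \<and> nth_eve \<rho> (i - 1) a) \<longleftrightarrow> Eves \<Lambda> \<rho> i \<in> B" if "\<rho> \<in> ?O" for \<rho>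
        using E[OF that] Eves_CDI_coming_down[of \<rho> "Eves \<Lambda> \<rho>"] True i by (simp add: is_Eves_def)
      then have "(\<lambda>\<rho>. Eves \<Lambda> \<rho> i) -` B \<inter> space ?R = {\<rho> \<in> space Q. \<exists>a. a \<in> B \<and> nth_eve \<rho> (i - 1) a} \<inter> ?O"
        unfolding space_R space_Q by (intro set_eqI) auto
      ultimately show "(\<lambda>\<rho>. Eves \<Lambda> \<rho> i) -` B \<inter> space ?R \<in> sets ?R"
        unfolding sets_restrict_space
        by (intro image_eqI[of _ _ "{\<rho> \<in> space Q. \<exists>a. a \<in> B \<and> nth_eve \<rho> (i - 1) a}"]) auto
    qed simp
  qed
  have "(\<lambda>\<rho> i. Eves \<Lambda> \<rho> i) \<in> ?R \<rightarrow>\<^sub>M PiM {1..} (\<lambda>_. unit_borel)"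
  proof (rule measurable_PiM_single')
    fix i :: nat assume "i \<in> {1..}"
    then have i: "1 \<le> i" by simp
    show "(\<lambda>\<rho>. Eves \<Lambda> \<rho> i) \<in> ?R \<rightarrow>\<^sub>M unit_borel"
      unfolding unit_borel_def
    proof (rule measurable_restrict_space2[OF _ borel[OF i]])
      show "(\<lambda>\<rho>. Eves \<Lambda> \<rho> i) \<in> space ?R \<rightarrow> {0..1}"
        unfolding space_R by (intro funcsetI PiE_mem[OF range]) (use i in auto)
    qed
  next
    show "(\<lambda>\<rho> i. Eves \<Lambda> \<rho> i) \<in> space ?R \<rightarrow> ({1..} \<rightarrow>\<^sub>E space unit_borel)"
      unfolding space_R using range by (simp add: unit_borel_def space_restrict_space)
  qed
  then show ?thesis by simp
qed

end

theorem proposition3p1: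
  fixes \<Lambda> :: "real measure"
    and M :: "'w measure"
    and X :: "'w \<Rightarrow> real \<Rightarrow> real measure"
    and P :: "(real \<Rightarrow> real measure) measure"
    and Eve_set :: "(real \<Rightarrow> real measure) set"
  assumes "finite_measure \<Lambda>"
    and "sets \<Lambda> = sets unit_borel"
    and "measure \<Lambda> {1} = 0"
    and "Lambda_Fleming_Viot \<Lambda> M X"
    and "P = distr M (borel_of skorohod_topology) X"
    and "Eve_set = {\<rho> \<in> skorohod_space. admits_Eves \<Lambda> \<rho>}"
  shows "Eve_set \<in> sets (completion P) \<and>
    Eves \<Lambda> \<in> measurable (restrict_space (completion P) Eve_set) (PiM {1..} (\<lambda>_. unit_borel))"
proof -
  have X: "prob_space M" "X \<in> M \<rightarrow>\<^sub>M borel_of skorohod_topology"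
    using assms(4) by (auto simp: Lambda_Fleming_Viot_def)
  interpret P: prob_space P
    unfolding assms(5) using X by (rule prob_space.prob_space_distr)
  have opens: "{U. openin skorohod_topology U} \<subseteq> Pow (topspace skorohod_topology)"
    by (auto dest: openin_subset)
  have space_P: "space P = skorohod_space"
    unfolding assms(5) space_distr borel_of_def space_measure_of[OF opens] by (rule topspace_skorohod_topology)
  have open_P: "U \<in> sets P" if "skorohod_open U" for U
    unfolding assms(5) sets_distr borel_of_def sets_measure_of[OF opens]
    using that by (intro sigma_sets.Basic) (simp add: openin_skorohod_topology)
  \<comment> \<open>The completion carries the Borel sigma-field augmented by the null sets. It
    keeps total mass \<open>1\<close> and contains the Skorohod open sets, so what was proved for
    \<open>Q\<close> applies to it.\<close>
  have "finite_measure (completion P)" by (rule finite_measureI) simp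
  then interpret Q: skorohod_measure "completion P"
    by (intro skorohod_measure.intro skorohod_measure_axioms.intro completion.complete_measure_axioms)
       (simp_all add: space_P open_P)
  show ?thesis unfolding assms(6) using Q.admits_Eves_measurable Q.Eves_measurable by blast
qed

end
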